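(* Let $W$ be the Weyl group of a simply connected, connected, semisimple complex algebraic group, let $\Gamma$ be its Dynkin diagram, and let $u,v\in W$. Then the BFZ quiver $Q^{u,v}$ can be realized as a dimer quiver (dimer model) on the cylinder $\Gamma\times\mathbb R^{\ge0}$ over $\Gamma$.
   Context: **Graph.** Let $A=(a_{ij})$ be the $r\times r$ Cartan matrix. $\Gamma$ is regarded as the graph on $\{1,\dots,r\}$ with one edge between $i\neq j$ whenever $a_{ij}<0$. $s_1,\dots,s_r$ are the simple reflections and $\ell$ the length function of $W$. **Words.** For $u,v\in W$ let $N=\ell(u)+\ell(v)$. A reduced word $\mathbf i=(i_1,\dots,i_N)$ of $(u,v)$ is an arbitrary shuffle of a reduced word of $u$, written with negative indices $-1,\dots,-r$, and a reduced word of $v$, written with positive indices. Put $i_{-j}=-j$ for $1\le j\le r$. The index set is $I=\{-r,\dots,-1\}\cup\{1,\dots,N\}$ with its usual order. For $k\in I$, $k^+$ is the smallest $l\in I$ with $l>k$ and $|i_l|=|i_k|$; if there is none, $k^+=N+1$. $\epsilon(x)=\pm1$ is the sign of $x$. An index $k$ is exchangeable if both $k$ and $k^+$ lie in $\{1,\dots,N\}$. **BFZ quiver $Q^{u,v}$** (for a reduced word $\mathbf i$ of $(u,v)$). The vertex set is $I$; exchangeable vertices are mutable and the others frozen. The arrows are: - Vertical: for each $k$ with $l=k^+\le N$, an arrow $k\to l$ if $\epsilon(i_l)=+1$, and $l\to k$ if $\epsilon(i_l)=-1$. - Inclined: for $k<l$ with $l\ge 1$ and $a_{|i_k|,|i_l|}<0$,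 there is one arrow between $k$ and $l$ if either (1) $l<k^+<l^+$ and $\epsilon(i_l)=\epsilon(i_{k^+})$, or (2) $l<l^+<k^+$ and $\epsilon(i_l)=-\epsilon(i_{l^+})$. It is directed $k\to l$ if $\epsilon(i_l)=-1$ and $l\to k$ if $\epsilon(i_l)=+1$. - Boundary arrows between frozen vertices completing oriented simple cycles: for each edge $\{i,j\}$ of $\Gamma$ such that at least one of $\pm i,\pm j$ occurs in $(i_1,\dots,i_N)$, there is one arrow between $-i$ and $-j$ and one arrow between $t_i$ and $t_j$, where $t_h$ is the largest $k\in I$ with $|i_k|=h$. If the first letter of $(i_1,\dots,i_N)$ with absolute value in $\{i,j\}$ has absolute value $j$, the first arrow is $-i\to -j$ if that letter is positive and $-j\to -i$ if negative. If the last such letter has absolute value $j$, the second arrow is $t_j\to t_i$ if that letter is positive and $t_i\to t_j$ if negative. (Similarly with $i,j$ exchanged.) **Cylinder.** The cylinder over $\Gamma$ is $\Gamma\times\mathbb R^{\ge0}$. The string over a vertex $x$ of $\Gamma$ is $\{x\}\times\mathbb R^{\ge0}$; the string over a ramification point (a vertex with more than two incident edges) is a spine. A strip is (edge of $\Gamma$)$\times\mathbb R^{\ge0}$. A quiver is drawn on the cylinder with its vertices on the strings. $Q^{u,v}$ is drawn by placing vertex $k\in I$ on the string over $|i_k|$ at height equal to its position in the ordered set $I$, with vertical arrows along the strings and all other arrows as straight segments in strips. A face is a bounded region cut out by the arrows whose boundary consists entirely of arrows; it is oriented if the arrows on its boundary form an oriented cycle. **Dimer quiver.** A quiver on the cylinder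 over $\Gamma$ (with some vertices declared frozen) is a dimer quiver (dimer model) on the cylinder if: 1. each arrow projects onto an edge or a vertex of $\Gamma$; 2. each face projects onto an edge of $\Gamma$; 3. each face is oriented; 4. the first and last vertices on each string are frozen, and the first and last faces on each strip have an edge that connects two frozen vertices; 5. two (distinct) faces do not share two edges unless their common string is a spine. *)

theory Defs
  imports "HOL-Analysis.Analysis" "Graph_Theory.Arc_Walk"
begin

section \<open>Dimer quivers on the cylinder over a graph\<close>

text \<open>
  A finite simple graph consists of a set V of vertices (natural numbers) and a set E of
  two-element subsets of V.  Its geometric realization is taken inside \<^typ>\<open>nat \<Rightarrow> real\<close>, with
  the vertex i placed at the i-th unit vector; \<open>cell {i}\<close> is that point and \<open>cell {i, j}\<close>
  is the closed edge joining the points i and j.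
\<close>

definition cell :: "nat set \<Rightarrow> (nat \<Rightarrow> real) set" where
  "cell S = {x. (\<forall>n. 0 \<le> x n) \<and> (\<forall>n. n \<notin> S \<longrightarrow> x n = 0) \<and> (\<Sum>n\<in>S. x n) = 1}"

definition realization :: "nat set \<Rightarrow> nat set set \<Rightarrow> (nat \<Rightarrow> real) set" where
  "realization V E = (\<Union>i\<in>V. cell {i}) \<union> (\<Union>e\<in>E. cell e)"

definition cylinder :: "nat set \<Rightarrow> nat set set \<Rightarrow> ((nat \<Rightarrow> real) \<times> real) set" where
  "cylinder V E = realization V E \<times> {0..}"

definition ramification :: "nat set set \<Rightarrow> nat \<Rightarrow> bool" where
  "ramification E i \<longleftrightarrow> card {e \<in> E. i \<in> e} > 2"

definition string_point :: "nat \<Rightarrow> real \<Rightarrow> (nat \<Rightarrow> real) \<times> real" where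
  "string_point i h = (indicator {i}, h)"

text \<open>
  A quiver is a finite directed multigraph.  The vertex v is drawn on the string over
  \<open>strand v\<close> at height \<open>height v\<close>, the arrow a is drawn as the curve \<open>curve a\<close> (defined on the
  unit interval), and the drawing is an embedding.
\<close>

locale quiver_on_cylinder = fin_digraph Q
  for Q :: "('v, 'a) pre_digraph" +
  fixes V :: "nat set" and E :: "nat set set"
    and frozen :: "'v set"
    and strand :: "'v \<Rightarrow> nat" and height :: "'v \<Rightarrow> real"
    and curve :: "'a \<Rightarrow> real \<Rightarrow> (nat \<Rightarrow> real) \<times> real"
  assumes finite_V: "finite V"
    and edges: "\<And>e. e \<in> E \<Longrightarrow> e \<subseteq> V \<and> card e = 2"
    and frozen_verts: "frozen \<subseteq> verts Q"
    and on_string: "\<And>v. v \<in> verts Q \<Longrightarrow> strand v \<in> V \<and> height v \<ge> 0"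
    and distinct_places: "inj_on (\<lambda>v. (strand v, height v)) (verts Q)"
    and curve_simple: "\<And>a. a \<in> arcs Q \<Longrightarrow> simple_path (curve a)"
    and curve_cylinder: "\<And>a. a \<in> arcs Q \<Longrightarrow> path_image (curve a) \<subseteq> cylinder V E"
    and curve_start: "\<And>a. a \<in> arcs Q \<Longrightarrow>
      pathstart (curve a) = string_point (strand (tail Q a)) (height (tail Q a))"
    and curve_finish: "\<And>a. a \<in> arcs Q \<Longrightarrow>
      pathfinish (curve a) = string_point (strand (head Q a)) (height (head Q a))"
    and curve_avoids_vertices: "\<And>a v. \<lbrakk>a \<in> arcs Q; v \<in> verts Q;
      string_point (strand v) (height v) \<in> path_image (curve a)\<rbrakk> \<Longrightarrow> v = tail Q a \<or> v = head Q a"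
    and curves_noncrossing: "\<And>a b. \<lbrakk>a \<in> arcs Q; b \<in> arcs Q; a \<noteq> b\<rbrakk> \<Longrightarrow>
      path_image (curve a) \<inter> path_image (curve b) \<subseteq>
        {pathstart (curve a), pathfinish (curve a)} \<inter> {pathstart (curve b), pathfinish (curve b)}"
begin

definition region :: "((nat \<Rightarrow> real) \<times> real) set \<Rightarrow> bool" where
  "region F \<longleftrightarrow> F \<in> components (cylinder V E - (\<Union>a\<in>arcs Q. path_image (curve a)))"

text \<open>
  The boundary is taken in the two-sided infinite cylinder, so that the points of the base
  \<open>realization V E \<times> {0}\<close> lying in a region count as boundary points of it.  Otherwise the
  region between the base of the cylinder and the lowest arrows could pass for a face.
\<close>

definition boundary :: "((nat \<Rightarrow> real) \<times> real) set \<Rightarrow> ((nat \<Rightarrow> real) \<times> real) set" where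
  "boundary F = top_of_set (realization V E \<times> UNIV) frontier_of F"

definition boundary_arcs :: "((nat \<Rightarrow> real) \<times> real) set \<Rightarrow> 'a set" where
  "boundary_arcs F = {a \<in> arcs Q. path_image (curve a) \<subseteq> boundary F}"

definition face :: "((nat \<Rightarrow> real) \<times> real) set \<Rightarrow> bool" where
  "face F \<longleftrightarrow> region F \<and> bounded F \<and> boundary F = (\<Union>a\<in>boundary_arcs F. path_image (curve a))"

text \<open>Faces are open regions, so the closure is what projects onto the whole closed edge.\<close>

definition face_on_strip :: "nat set \<Rightarrow> ((nat \<Rightarrow> real) \<times> real) set \<Rightarrow> bool" where
  "face_on_strip e F \<longleftrightarrow> face F \<and> fst ` closure F = cell e"

definition oriented :: "((nat \<Rightarrow> real) \<times> real) set \<Rightarrow> bool" where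
  "oriented F \<longleftrightarrow> (\<exists>p. cycle p \<and> set p = boundary_arcs F)"

definition below :: "((nat \<Rightarrow> real) \<times> real) set \<Rightarrow> ((nat \<Rightarrow> real) \<times> real) set \<Rightarrow> bool" where
  "below F G \<longleftrightarrow> (\<forall>x s t. (x, s) \<in> F \<longrightarrow> (x, t) \<in> G \<longrightarrow> s < t)"

definition first_face :: "nat set \<Rightarrow> ((nat \<Rightarrow> real) \<times> real) set \<Rightarrow> bool" where
  "first_face e F \<longleftrightarrow> face_on_strip e F \<and> (\<forall>G. face_on_strip e G \<longrightarrow> G \<noteq> F \<longrightarrow> below F G)"

definition last_face :: "nat set \<Rightarrow> ((nat \<Rightarrow> real) \<times> real) set \<Rightarrow> bool" where
  "last_face e F \<longleftrightarrow> face_on_strip e F \<and> (\<forall>G. face_on_strip e G \<longrightarrow> G \<noteq> F \<longrightarrow> below G F)"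

definition has_frozen_arrow :: "((nat \<Rightarrow> real) \<times> real) set \<Rightarrow> bool" where
  "has_frozen_arrow F \<longleftrightarrow> (\<exists>a\<in>boundary_arcs F. tail Q a \<in> frozen \<and> head Q a \<in> frozen)"

end

text \<open>
  A strip that carries no arrows has no faces; the condition on its first and last face is then
  void.  If a strip has a face, the existence of a first and of a last face is part of the
  condition.  In the last condition the common string of two faces is the string over x where
  the faces lie on two different strips meeting in x; faces on the same strip are never exempt.
\<close>

locale dimer_quiver = quiver_on_cylinder +
  assumes arrows_project: "\<And>a. a \<in> arcs Q \<Longrightarrow>
      (\<exists>i\<in>V. fst ` path_image (curve a) = cell {i}) \<or>
      (\<exists>e\<in>E. fst ` path_image (curve a) = cell e)"
    and faces_project: "\<And>F. face F \<Longrightarrow> \<exists>e\<in>E. face_on_strip e F"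
    and faces_oriented: "\<And>F. face F \<Longrightarrow> oriented F"
    and first_vertex_frozen: "\<And>v. \<lbrakk>v \<in> verts Q;
      \<And>w. \<lbrakk>w \<in> verts Q; strand w = strand v\<rbrakk> \<Longrightarrow> height v \<le> height w\<rbrakk> \<Longrightarrow> v \<in> frozen"
    and last_vertex_frozen: "\<And>v. \<lbrakk>v \<in> verts Q;
      \<And>w. \<lbrakk>w \<in> verts Q; strand w = strand v\<rbrakk> \<Longrightarrow> height w \<le> height v\<rbrakk> \<Longrightarrow> v \<in> frozen"
    and first_face_frozen: "\<And>e F. \<lbrakk>e \<in> E; face_on_strip e F\<rbrakk> \<Longrightarrow>
      \<exists>G. first_face e G \<and> has_frozen_arrow G"
    and last_face_frozen: "\<And>e F. \<lbrakk>e \<in> E; face_on_strip e F\<rbrakk> \<Longrightarrow>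
      \<exists>G. last_face e G \<and> has_frozen_arrow G"
    and shared_arrows: "\<And>F G a b. \<lbrakk>face F; face G; F \<noteq> G; a \<noteq> b;
      {a, b} \<subseteq> boundary_arcs F \<inter> boundary_arcs G\<rbrakk> \<Longrightarrow>
      \<exists>x e e'. e \<in> E \<and> e' \<in> E \<and> face_on_strip e F \<and> face_on_strip e' G \<and>
        e \<inter> e' = {x} \<and> ramification E x"


section \<open>Cartan matrices, Weyl groups and reduced words\<close>

text \<open>
  Cartan matrices of finite type, not necessarily indecomposable, with rows and columns indexed by
  1..r.  These are exactly the Cartan matrices of the simply connected, connected, semisimple
  complex algebraic groups of rank r.
\<close>

definition cartan_matrix :: "nat \<Rightarrow> (nat \<Rightarrow> nat \<Rightarrow> int) \<Rightarrow> bool" where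
  "cartan_matrix r A \<longleftrightarrow>
    (\<forall>i\<in>{1..r}. A i i = 2) \<and>
    (\<forall>i\<in>{1..r}. \<forall>j\<in>{1..r}. i \<noteq> j \<longrightarrow> A i j \<le> 0 \<and> (A i j = 0 \<longleftrightarrow> A j i = 0)) \<and>
    (\<exists>d :: nat \<Rightarrow> real. (\<forall>i\<in>{1..r}. d i > 0) \<and>
      (\<forall>i\<in>{1..r}. \<forall>j\<in>{1..r}. d i * of_int (A i j) = d j * of_int (A j i)) \<and>
      (\<forall>x :: nat \<Rightarrow> real. (\<exists>i\<in>{1..r}. x i \<noteq> 0) \<longrightarrow>
        (\<Sum>i=1..r. \<Sum>j=1..r. d i * of_int (A i j) * x i * x j) > 0))"

definition dynkin_edges :: "nat \<Rightarrow> (nat \<Rightarrow> nat \<Rightarrow> int) \<Rightarrow> nat set set" where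
  "dynkin_edges r A = {{i, j} | i j. i \<in> {1..r} \<and> j \<in> {1..r} \<and> i \<noteq> j \<and> A i j < 0}"

text \<open>
  The action of the i-th simple reflection on the root lattice, where \<open>x j\<close> is the coefficient of
  the j-th simple root: it sends the j-th simple root to itself minus \<open>A i j\<close> times the i-th one.
  Coordinates outside 1..r are left alone, so this is a faithful action of the Weyl group.
\<close>

definition simple_reflection ::
    "nat \<Rightarrow> (nat \<Rightarrow> nat \<Rightarrow> int) \<Rightarrow> nat \<Rightarrow> (nat \<Rightarrow> int) \<Rightarrow> (nat \<Rightarrow> int)" where
  "simple_reflection r A i x = x(i := x i - (\<Sum>j=1..r. A i j * x j))"

definition word_product ::
    "nat \<Rightarrow> (nat \<Rightarrow> nat \<Rightarrow> int) \<Rightarrow> nat list \<Rightarrow> (nat \<Rightarrow> int) \<Rightarrow> (nat \<Rightarrow> int)" where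
  "word_product r A w = foldr (\<lambda>i f. simple_reflection r A i \<circ> f) w id"

text \<open>Simple reflections are involutions, so products of them already form a group.\<close>

definition weyl_group :: "nat \<Rightarrow> (nat \<Rightarrow> nat \<Rightarrow> int) \<Rightarrow> ((nat \<Rightarrow> int) \<Rightarrow> (nat \<Rightarrow> int)) set" where
  "weyl_group r A = {word_product r A w | w. set w \<subseteq> {1..r}}"

definition weyl_length ::
    "nat \<Rightarrow> (nat \<Rightarrow> nat \<Rightarrow> int) \<Rightarrow> ((nat \<Rightarrow> int) \<Rightarrow> (nat \<Rightarrow> int)) \<Rightarrow> nat" where
  "weyl_length r A u = (LEAST n. \<exists>w. set w \<subseteq> {1..r} \<and> word_product r A w = u \<and> length w = n)"

definition reduced_word ::
    "nat \<Rightarrow> (nat \<Rightarrow> nat \<Rightarrow> int) \<Rightarrow> ((nat \<Rightarrow> int) \<Rightarrow> (nat \<Rightarrow> int)) \<Rightarrow> nat list \<Rightarrow> bool" where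
  "reduced_word r A u w \<longleftrightarrow>
    set w \<subseteq> {1..r} \<and> word_product r A w = u \<and> length w = weyl_length r A u"

definition double_reduced_word ::
    "nat \<Rightarrow> (nat \<Rightarrow> nat \<Rightarrow> int) \<Rightarrow> ((nat \<Rightarrow> int) \<Rightarrow> (nat \<Rightarrow> int)) \<Rightarrow> ((nat \<Rightarrow> int) \<Rightarrow> (nat \<Rightarrow> int))
      \<Rightarrow> int list \<Rightarrow> bool" where
  "double_reduced_word r A u v w \<longleftrightarrow>
    (\<exists>wu wv. reduced_word r A u wu \<and> reduced_word r A v wv \<and>
      w \<in> shuffles (map (\<lambda>i. - int i) wu) (map int wv))"


section \<open>The Berenstein--Fomin--Zelevinsky quiver of a word\<close>

definition index_set :: "nat \<Rightarrow> int list \<Rightarrow> int set" where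
  "index_set r w = {- int r..-1} \<union> {1..int (length w)}"

definition letter :: "int list \<Rightarrow> int \<Rightarrow> int" where
  "letter w k = (if k < 0 then k else w ! (nat k - 1))"

definition bfz_strand :: "int list \<Rightarrow> int \<Rightarrow> nat" where
  "bfz_strand w k = nat \<bar>letter w k\<bar>"

definition next_index :: "nat \<Rightarrow> int list \<Rightarrow> int \<Rightarrow> int" where
  "next_index r w k =
    (let S = {l \<in> index_set r w. k < l \<and> bfz_strand w l = bfz_strand w k}
     in if S = {} then int (length w) + 1 else Min S)"

definition exchangeable :: "nat \<Rightarrow> int list \<Rightarrow> int \<Rightarrow> bool" where
  "exchangeable r w k \<longleftrightarrow> k \<in> {1..int (length w)} \<and> next_index r w k \<in> {1..int (length w)}"

definition bfz_frozen :: "nat \<Rightarrow> int list \<Rightarrow> int set" where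
  "bfz_frozen r w = {k \<in> index_set r w. \<not> exchangeable r w k}"

text \<open>Arrows are tagged by their kind, so that coinciding arrows would not be identified.\<close>

datatype bfz_arrow =
    Vertical (arrow_tail: int) (arrow_head: int)
  | Inclined (arrow_tail: int) (arrow_head: int)
  | Bottom (arrow_tail: int) (arrow_head: int)
  | Top (arrow_tail: int) (arrow_head: int)

definition vertical_arrows :: "nat \<Rightarrow> int list \<Rightarrow> bfz_arrow set" where
  "vertical_arrows r w =
    {if letter w l > 0 then Vertical k l else Vertical l k | k l.
      k \<in> index_set r w \<and> l = next_index r w k \<and> l \<le> int (length w)}"

definition inclined_arrows :: "nat \<Rightarrow> (nat \<Rightarrow> nat \<Rightarrow> int) \<Rightarrow> int list \<Rightarrow> bfz_arrow set" where
  "inclined_arrows r A w =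
    {if letter w l < 0 then Inclined k l else Inclined l k | k l.
      k \<in> index_set r w \<and> l \<in> index_set r w \<and> k < l \<and> 1 \<le> l \<and>
      A (bfz_strand w k) (bfz_strand w l) < 0 \<and>
      (l < next_index r w k \<and> next_index r w k < next_index r w l \<and>
         sgn (letter w l) = sgn (letter w (next_index r w k)) \<or>
       l < next_index r w l \<and> next_index r w l < next_index r w k \<and>
         sgn (letter w l) = - sgn (letter w (next_index r w l)))}"

text \<open>The subword of letters whose absolute value is i or j.\<close>

definition edge_letters :: "int list \<Rightarrow> nat \<Rightarrow> nat \<Rightarrow> int list" where
  "edge_letters w i j = filter (\<lambda>x. nat \<bar>x\<bar> \<in> {i, j}) w"

definition last_index :: "nat \<Rightarrow> int list \<Rightarrow> nat \<Rightarrow> int" where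
  "last_index r w h = Max {k \<in> index_set r w. bfz_strand w k = h}"

text \<open>
  Both orderings (i, j) and (j, i) of an edge are covered; the condition that the first (last)
  letter has absolute value j selects exactly one of them.
\<close>

definition bottom_arrows :: "nat \<Rightarrow> (nat \<Rightarrow> nat \<Rightarrow> int) \<Rightarrow> int list \<Rightarrow> bfz_arrow set" where
  "bottom_arrows r A w =
    {if hd (edge_letters w i j) > 0 then Bottom (- int i) (- int j) else Bottom (- int j) (- int i)
      | i j. {i, j} \<in> dynkin_edges r A \<and> edge_letters w i j \<noteq> [] \<and>
             nat \<bar>hd (edge_letters w i j)\<bar> = j}"

definition top_arrows :: "nat \<Rightarrow> (nat \<Rightarrow> nat \<Rightarrow> int) \<Rightarrow> int list \<Rightarrow> bfz_arrow set" where
  "top_arrows r A w =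
    {if last (edge_letters w i j) > 0 then Top (last_index r w j) (last_index r w i)
     else Top (last_index r w i) (last_index r w j)
      | i j. {i, j} \<in> dynkin_edges r A \<and> edge_letters w i j \<noteq> [] \<and>
             nat \<bar>last (edge_letters w i j)\<bar> = j}"

definition bfz_quiver ::
    "nat \<Rightarrow> (nat \<Rightarrow> nat \<Rightarrow> int) \<Rightarrow> int list \<Rightarrow> (int, bfz_arrow) pre_digraph" where
  "bfz_quiver r A w =
    \<lparr>verts = index_set r w,
     arcs = vertical_arrows r w \<union> inclined_arrows r A w \<union> bottom_arrows r A w \<union> top_arrows r A w,
     tail = arrow_tail,
     head = arrow_head\<rparr>"

definition bfz_height :: "nat \<Rightarrow> int list \<Rightarrow> int \<Rightarrow> real" where
  "bfz_height r w k = real (card {l \<in> index_set r w. l \<le> k})"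

definition straight_segment ::
    "nat \<times> real \<Rightarrow> nat \<times> real \<Rightarrow> real \<Rightarrow> (nat \<Rightarrow> real) \<times> real" where
  "straight_segment p q t =
    (\<lambda>n. (1 - t) * indicator {fst p} n + t * indicator {fst q} n, (1 - t) * snd p + t * snd q)"

definition bfz_curve :: "nat \<Rightarrow> int list \<Rightarrow> bfz_arrow \<Rightarrow> real \<Rightarrow> (nat \<Rightarrow> real) \<times> real" where
  "bfz_curve r w a =
    straight_segment (bfz_strand w (arrow_tail a), bfz_height r w (arrow_tail a))
                     (bfz_strand w (arrow_head a), bfz_height r w (arrow_head a))"

end

theory Submission
  imports Defs
begin

text \<open>
  Everything happens strip by strip. Fix an edge \<open>{i, j}\<close> and read the letters over i or j in
  their order. The vertical arrow below a letter points up if the letter is positive and down if it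
  is negative. Call a letter upward (with respect to j) if its arrow goes up along j or down along i,
  so that it runs around the strip in one fixed direction. The case distinction that defines the
  inclined arrows then has a simple meaning (\<open>inclined_arrows_eq\<close>): after a letter that is not
  the last one of the strip, an arrow joins the two vertices that are topmost at that moment if and
  only if the next letter of the strip has the other direction. The boundary arrows add such a
  crossing arrow at the bottom and at the top. So the slanted arrows cut the sequence of letters of the
  strip into maximal blocks of equally directed letters.

  Both ends of the slanted arrows move up with the position of the cut, so these arrows do not cross.
  Two consecutive cuts bound a slab, whose sides are the vertical arrows of the letters of the block.
  These all run around the slab in the same direction, and the rule for directing slanted arrows
  lets the two cuts close them up to an oriented cycle (\<open>block_cut_arrow_ends\<close>,
  \<open>block_arrows_upward_cycle\<close>).

  There are no other faces (\<open>face_is_block_face\<close>). A point with no arrow vertically below it is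
  connected to the base, and a point with no arrow vertically above it lies in an unbounded region;
  any other point of the complement of the arrows lies between two consecutive cuts of one strip.
  The lowest and the highest slab of a strip contain the bottom and the top arrow, which join frozen
  vertices.

  Reducedness limits the arrows that two faces share (\<open>two_shared_verticals_ramify\<close>).
  Faces on one strip share at most a cut. Faces on two strips at x share vertical arrows over x; if
  they share two, then two consecutive letters x of the same sign have, on both strips, only letters
  of the opposite sign over the neighbour of x between them. If x has no further neighbours, then in
  the reduced word of that sign the letters between the two occurrences of x commute with x, and the
  two occurrences cancel (\<open>reduced_word_separated\<close>).
\<close>

section \<open>Strips of the cylinder\<close>

text \<open>
  The points of the segment that joins height a on the string over i to height b on the string
  over j are the \<open>(x, tilt i j a b x)\<close> with x in the edge: in the coordinates of
  \<^const>\<open>cell\<close> linear interpolation is this linear form, and it is symmetric in the two ends.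
\<close>

definition tilt :: "nat \<Rightarrow> nat \<Rightarrow> real \<Rightarrow> real \<Rightarrow> (nat \<Rightarrow> real) \<Rightarrow> real" where
  "tilt i j a b x = a * x i + b * x j"

definition slanted_segment :: "nat \<Rightarrow> nat \<Rightarrow> real \<Rightarrow> real \<Rightarrow> ((nat \<Rightarrow> real) \<times> real) set" where
  "slanted_segment i j a b = {(x, h). x \<in> cell {i, j} \<and> h = tilt i j a b x}"

lemma tilt_commute: "tilt i j a b = tilt j i b a"
  by (auto simp: tilt_def)

lemma slanted_segment_commute: "slanted_segment i j a b = slanted_segment j i b a"
  by (simp add: slanted_segment_def tilt_commute insert_commute)

lemma tilt_indicator [simp]:
  "i \<noteq> j \<Longrightarrow> tilt i j a b (indicator {i}) = a" "i \<noteq> j \<Longrightarrow> tilt i j a b (indicator {j}) = b"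
  by (auto simp: tilt_def)

lemma tilt_mono:
  assumes "a \<le> a'" "b \<le> b'" "0 \<le> x i" "0 \<le> x j"
  shows "tilt i j a b x \<le> tilt i j a' b' x"
  unfolding tilt_def using assms by (intro add_mono mult_right_mono) auto

lemma tilt_strict_mono:
  assumes "a \<le> a'" "b \<le> b'" "a < a' \<or> b < b'" "0 < x i" "0 < x j"
  shows "tilt i j a b x < tilt i j a' b' x"
proof (cases "a < a'")
  case True
  then show ?thesis unfolding tilt_def using assms
    by (intro add_less_le_mono mult_right_mono mult_strict_right_mono) auto
next
  case False
  then show ?thesis unfolding tilt_def using assms
    by (intro add_le_less_mono mult_right_mono mult_strict_right_mono) auto
qed

lemma cell_singleton: "cell {i} = {indicator {i}}"
  by (auto simp: cell_def fun_eq_iff indicator_def)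

lemma cell_pair_iff:
  assumes "i \<noteq> j"
  shows "x \<in> cell {i, j} \<longleftrightarrow>
    0 \<le> x i \<and> 0 \<le> x j \<and> x i + x j = 1 \<and> (\<forall>n. n \<noteq> i \<longrightarrow> n \<noteq> j \<longrightarrow> x n = 0)"
  using assms by (auto simp: cell_def)

lemma indicator_in_cell_pair:
  assumes "i \<noteq> j"
  shows "indicator {k} \<in> cell {i, j} \<longleftrightarrow> k \<in> {i, j}"
  using assms by (auto simp: cell_pair_iff indicator_def)

lemma cell_pair_ends:
  assumes "i \<noteq> j" "x \<in> cell {i, j}"
  shows "x i = 0 \<Longrightarrow> x = indicator {j}" "x j = 0 \<Longrightarrow> x = indicator {i}"
  using assms by (auto simp: cell_pair_iff fun_eq_iff indicator_def)

text \<open>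
  A point of the open edge has two positive coordinates, so no other edge contains it. Hence
  anything that happens over an open edge concerns one strip only.
\<close>

lemma cell_meeting_open_edge:
  assumes "i \<noteq> j" "card e = 2" "x \<in> cell {i, j}" "x \<in> cell e" "0 < x i" "0 < x j"
  shows "e = {i, j}"
proof -
  have "i \<in> e" "j \<in> e" using assms by (auto simp: cell_def)
  then show ?thesis using assms
    by (auto simp: card_2_iff)
qed

lemma cell_pair_param:
  assumes "i \<noteq> j"
  shows "(\<lambda>n. (1 - t) * indicator {i} n + t * indicator {j} n) \<in> cell {i, j} \<longleftrightarrow> t \<in> {0..1}"
  using assms by (auto simp: cell_pair_iff indicator_def)

lemma cell_pair_eq_param:
  assumes "i \<noteq> j" "x \<in> cell {i, j}"
  shows "x = (\<lambda>n. (1 - x j) * indicator {i} n + x j * indicator {j} n)"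
  using assms by (auto simp: cell_pair_iff fun_eq_iff indicator_def)

lemma cell_pair_interior: "i \<noteq> j \<Longrightarrow> \<exists>x. x \<in> cell {i, j} \<and> 0 < x i \<and> 0 < x j"
proof -
  assume ij: "i \<noteq> j"
  obtain t :: real where t: "0 < t" "t < 1" using dense zero_less_one by blast
  show ?thesis
    by (rule exI[of _ "\<lambda>n. (1 - t) * indicator {i} n + t * indicator {j} n"])
      (use ij t in \<open>auto simp: cell_pair_param\<close>)
qed

lemma cell_eq_iff:
  assumes "card e = 2" "card e' = 2"
  shows "cell e = cell e' \<longleftrightarrow> e = e'"
proof
  have "k \<in> e' \<longleftrightarrow> indicator {k} \<in> cell e'" if "card e' = 2" for k e'
    using that indicator_in_cell_pair by (auto simp: card_2_iff)
  then show "cell e = cell e' \<Longrightarrow> e = e'" using assms by blast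
qed simp

lemma path_image_straight_slanted:
  assumes "i \<noteq> j"
  shows "path_image (straight_segment (i, a) (j, b)) = slanted_segment i j a b"
proof (intro equalityI subsetI)
  fix p assume "p \<in> path_image (straight_segment (i, a) (j, b))"
  then obtain t where "t \<in> {0..1}" "p = straight_segment (i, a) (j, b) t"
    by (auto simp: path_image_def)
  then show "p \<in> slanted_segment i j a b"
    using assms by (auto simp: slanted_segment_def straight_segment_def cell_pair_param tilt_def)
next
  fix p assume p: "p \<in> slanted_segment i j a b"
  obtain x h where xh: "p = (x, h)" by force
  have x: "x \<in> cell {i, j}" and h: "h = tilt i j a b x" using p xh by (auto simp: slanted_segment_def)
  have i: "x i = 1 - x j" "x j \<in> {0..1}" using x assms by (auto simp: cell_pair_iff)
  have "p = straight_segment (i, a) (j, b) (x j)"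
    using cell_pair_eq_param[OF assms x] i h xh by (simp add: straight_segment_def tilt_def)
  then show "p \<in> path_image (straight_segment (i, a) (j, b))"
    using i by (auto simp: path_image_def)
qed

lemma path_image_straight_vertical:
  "path_image (straight_segment (i, a) (i, b)) = {indicator {i}} \<times> closed_segment a b"
proof -
  have "straight_segment (i, a) (i, b) = (\<lambda>t. (indicator {i}, (1 - t) * a + t * b))"
    by (auto simp: straight_segment_def fun_eq_iff algebra_simps)
  then show ?thesis by (auto simp: path_image_def closed_segment_def image_iff)
qed

lemma path_straight_segment: "path (straight_segment p q)"
  unfolding path_def straight_segment_def
  by (intro continuous_on_Pair continuous_on_coordinatewise_then_product continuous_intros)

lemma simple_path_straight_segment:
  assumes "p \<noteq> q"
  shows "simple_path (straight_segment p q)"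
proof -
  have "inj_on (straight_segment p q) {0..1}"
  proof (rule inj_onI)
    fix s t assume eq: "straight_segment p q s = straight_segment p q t"
    show "s = t"
    proof (cases "fst p = fst q")
      case True
      then have "snd p \<noteq> snd q" using assms by (simp add: prod_eq_iff)
      moreover have "(t - s) * (snd p - snd q) = 0"
        using eq by (simp add: straight_segment_def algebra_simps)
      ultimately show ?thesis by simp
    next
      case False
      from eq have "fst (straight_segment p q s) (fst q) = fst (straight_segment p q t) (fst q)"
        by simp
      then show ?thesis using False by (simp add: straight_segment_def)
    qed
  qed
  then show ?thesis
    by (auto simp: simple_path_def loop_free_def path_straight_segment inj_on_def)
qed

lemma straight_segment_ends:
  "pathstart (straight_segment p q) = string_point (fst p) (snd p)"
  "pathfinish (straight_segment p q) = string_point (fst q) (snd q)"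
  by (auto simp: pathstart_def pathfinish_def straight_segment_def string_point_def)

lemma closed_cell: "finite S \<Longrightarrow> closed (cell S)"
  unfolding cell_def
  by (intro closed_Collect_conj closed_Collect_all closed_Collect_imp closed_Collect_le
      closed_Collect_eq open_Collect_const continuous_intros continuous_on_product_coordinates)

lemma continuous_on_fst_coordinate: "continuous_on S (\<lambda>p :: (nat \<Rightarrow> real) \<times> real. fst p n)"
  by (rule continuous_on_product_then_coordinatewise) (intro continuous_intros)

lemma continuous_on_tilt:
  "continuous_on S (\<lambda>p :: (nat \<Rightarrow> real) \<times> real. tilt i j a b (fst p))"
  unfolding tilt_def by (intro continuous_intros continuous_on_fst_coordinate)

text \<open>
  The region of a strip between two segments, the lower one joining heights a and b, the upper
  one a' and b'. The segments may share one end, in which case the region is a triangle.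
\<close>

locale slab =
  fixes i j :: nat and a b a' b' :: real
  assumes ij: "i \<noteq> j" and aa': "a \<le> a'" and bb': "b \<le> b'" and nontrivial: "a < a' \<or> b < b'"
begin

definition open_slab :: "((nat \<Rightarrow> real) \<times> real) set" where
  "open_slab = {(x, h). x \<in> cell {i, j} \<and> 0 < x i \<and> 0 < x j \<and>
     tilt i j a b x < h \<and> h < tilt i j a' b' x}"

definition closed_slab :: "((nat \<Rightarrow> real) \<times> real) set" where
  "closed_slab = {(x, h). x \<in> cell {i, j} \<and> tilt i j a b x \<le> h \<and> h \<le> tilt i j a' b' x}"

text \<open>
  The strip as a plane strip, where the slab becomes convex and the closed slab lies in a
  rectangle.
\<close>

definition chart :: "real \<times> real \<Rightarrow> (nat \<Rightarrow> real) \<times> real" where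
  "chart p = ((\<lambda>n. (1 - fst p) * indicator {i} n + fst p * indicator {j} n), snd p)"

lemma continuous_chart: "continuous_on S chart"
  unfolding chart_def
  by (intro continuous_on_Pair continuous_on_coordinatewise_then_product continuous_intros)

lemma open_subset_closed_slab: "open_slab \<subseteq> closed_slab"
  by (auto simp: open_slab_def closed_slab_def)

lemma closed_closed_slab: "closed closed_slab"
proof -
  have "closed_slab = (cell {i, j} \<times> UNIV) \<inter> {p. tilt i j a b (fst p) \<le> snd p}
      \<inter> {p. snd p \<le> tilt i j a' b' (fst p)}"
    by (auto simp: closed_slab_def)
  then show ?thesis
    by (simp only:) (intro closed_Int closed_Times closed_cell closed_Collect_le continuous_on_tilt
        continuous_intros closed_UNIV finite.intros)
qed

lemma bounded_closed_slab: "bounded closed_slab"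
proof -
  have "closed_slab \<subseteq> chart ` ({0..1} \<times> {- \<bar>a\<bar> - \<bar>b\<bar>..\<bar>a'\<bar> + \<bar>b'\<bar>})"
  proof
    fix p assume p: "p \<in> closed_slab"
    obtain x h where xh: "p = (x, h)" by force
    have x: "x \<in> cell {i, j}" and h: "tilt i j a b x \<le> h" "h \<le> tilt i j a' b' x"
      using p xh by (auto simp: closed_slab_def)
    have x01: "0 \<le> x i" "0 \<le> x j" "x i \<le> 1" "x j \<le> 1" using x ij by (auto simp: cell_pair_iff)
    have bd: "- \<bar>c\<bar> \<le> c * y \<and> c * y \<le> \<bar>c\<bar>" if "0 \<le> y" "y \<le> 1" for c y :: real
    proof -
      have "\<bar>c * y\<bar> \<le> \<bar>c\<bar>" using that by (simp add: abs_mult mult_left_le)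
      then show ?thesis by linarith
    qed
    have "- \<bar>a\<bar> - \<bar>b\<bar> \<le> h" "h \<le> \<bar>a'\<bar> + \<bar>b'\<bar>"
      using bd[of "x i" a] bd[of "x j" b] bd[of "x i" a'] bd[of "x j" b'] x01 h
      unfolding tilt_def by linarith+
    then have "h \<in> {- \<bar>a\<bar> - \<bar>b\<bar>..\<bar>a'\<bar> + \<bar>b'\<bar>}" by simp
    moreover have "p = chart (x j, h)"
      using cell_pair_eq_param[OF ij x] xh by (simp add: chart_def)
    ultimately show "p \<in> chart ` ({0..1} \<times> {- \<bar>a\<bar> - \<bar>b\<bar>..\<bar>a'\<bar> + \<bar>b'\<bar>})"
      using x01 by auto
  qed
  moreover have "compact (chart ` ({0..1} \<times> {- \<bar>a\<bar> - \<bar>b\<bar>..\<bar>a'\<bar> + \<bar>b'\<bar>}))"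
    by (intro compact_continuous_image continuous_chart compact_Times compact_Icc)
  ultimately show ?thesis using bounded_subset compact_imp_bounded by blast
qed

lemma bounded_open_slab: "bounded open_slab"
  using bounded_closed_slab open_subset_closed_slab bounded_subset by blast

text \<open>
  In the chart the slab is an intersection of four open half-planes.
\<close>

lemma connected_open_slab: "connected open_slab"
proof -
  \<comment> \<open>in the chart the first coordinate of p is the coordinate at j\<close>
  let ?C = "{p. 0 < fst p \<and> fst p < 1 \<and> a * (1 - fst p) + b * fst p < snd p \<and>
      snd p < a' * (1 - fst p) + b' * fst p} :: (real \<times> real) set"
  have conv: "convex {p :: real \<times> real. c * fst p + d * snd p < e}" for c d e
  proof -
    have "{p :: real \<times> real. c * fst p + d * snd p < e} = {p. (c, d) \<bullet> p < e}"
      by (auto simp: inner_prod_def)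
    then show ?thesis by (simp add: convex_halfspace_lt)
  qed
  have "?C = {p. (-1) * fst p + 0 * snd p < 0} \<inter> {p. 1 * fst p + 0 * snd p < 1}
    \<inter> {p. (b - a) * fst p + (-1) * snd p < - a} \<inter> {p. (a' - b') * fst p + 1 * snd p < a'}"
    by (auto simp: algebra_simps)
  then have "convex ?C" by (simp only:) (intro convex_Int conv)
  moreover have "open_slab = chart ` ?C"
  proof (intro equalityI subsetI)
    fix p assume p: "p \<in> open_slab"
    obtain x h where xh: "p = (x, h)" by force
    have x: "x \<in> cell {i, j}" using p xh by (auto simp: open_slab_def)
    then have xi: "x i = 1 - x j" using ij by (auto simp: cell_pair_iff)
    have "p = chart (x j, h)"
      using cell_pair_eq_param[OF ij x] xh by (simp add: chart_def)
    moreover have "(x j, h) \<in> ?C"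
      using p xh xi by (auto simp: open_slab_def tilt_def)
    ultimately show "p \<in> chart ` ?C" by blast
  next
    fix p assume "p \<in> chart ` ?C"
    then show "p \<in> open_slab"
      using ij by (auto simp: open_slab_def chart_def tilt_def cell_pair_param)
  qed
  ultimately show ?thesis
    by (simp add: connected_continuous_image continuous_chart convex_connected)
qed

lemma open_slab_point: "\<exists>x h. (x, h) \<in> open_slab"
proof -
  obtain x where x: "x \<in> cell {i, j}" "0 < x i" "0 < x j" using cell_pair_interior[OF ij] by blast
  have "tilt i j a b x < tilt i j a' b' x" by (intro tilt_strict_mono aa' bb' nontrivial x)
  then obtain h where "tilt i j a b x < h" "h < tilt i j a' b' x" using dense by blast
  then have "(x, h) \<in> open_slab" using x by (simp add: open_slab_def)
  then show ?thesis by blast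
qed

text \<open>
  Moving a point of the closed slab straight towards an interior point enters the open slab at
  once. This also covers the apex of a triangle.
\<close>

lemma closure_open_slab: "closure open_slab = closed_slab"
proof
  show "closure open_slab \<subseteq> closed_slab"
    using closed_closed_slab open_subset_closed_slab closure_minimal by blast
  show "closed_slab \<subseteq> closure open_slab"
  proof
    fix p assume p: "p \<in> closed_slab"
    obtain x h where xh: "p = (x, h)" by force
    obtain y k where yk: "(y, k) \<in> open_slab" using open_slab_point by blast
    \<comment> \<open>the straight line from (x, h) to (y, k)\<close>
    define g where "g t = ((\<lambda>n. (1 - t) * x n + t * y n), (1 - t) * h + t * k)" for t :: real
    have "g ` {0<..1} \<subseteq> open_slab"
    proof
      fix q assume "q \<in> g ` {0<..1}"
      then obtain t where t: "0 < t" "t \<le> 1" and q: "q = g t" by auto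
      let ?z = "\<lambda>n. (1 - t) * x n + t * y n"
      have x: "0 \<le> x i" "0 \<le> x j" "x i + x j = 1" "\<And>n. n \<noteq> i \<Longrightarrow> n \<noteq> j \<Longrightarrow> x n = 0"
        and h: "tilt i j a b x \<le> h" "h \<le> tilt i j a' b' x"
        using p xh ij by (auto simp: closed_slab_def cell_pair_iff)
      have y: "0 < y i" "0 < y j" "y i + y j = 1" "\<And>n. n \<noteq> i \<Longrightarrow> n \<noteq> j \<Longrightarrow> y n = 0"
        and k: "tilt i j a b y < k" "k < tilt i j a' b' y"
        using yk ij by (auto simp: open_slab_def cell_pair_iff)
      have lin: "tilt i j c d ?z = (1 - t) * tilt i j c d x + t * tilt i j c d y" for c d
        by (simp add: tilt_def algebra_simps)
      have pos: "0 < ?z i" "0 < ?z j" using x y t by (simp_all add: add_nonneg_pos)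
      have "?z i + ?z j = (1 - t) * (x i + x j) + t * (y i + y j)" by (simp add: algebra_simps)
      then have "?z i + ?z j = 1" using x y by simp
      then have "?z \<in> cell {i, j}" using pos x y ij by (auto simp: cell_pair_iff)
      moreover have "tilt i j a b ?z < (1 - t) * h + t * k"
        unfolding lin using h k t by (intro add_le_less_mono mult_left_mono mult_strict_left_mono) auto
      moreover have "(1 - t) * h + t * k < tilt i j a' b' ?z"
        unfolding lin using h k t by (intro add_le_less_mono mult_left_mono mult_strict_left_mono) auto
      ultimately show "q \<in> open_slab" using pos by (simp add: q g_def open_slab_def)
    qed
    moreover have "continuous_on (closure {0<..1}) g"
      unfolding g_def
      by (intro continuous_on_Pair continuous_on_coordinatewise_then_product continuous_intros)
    ultimately have "g ` closure {0<..1} \<subseteq> closure open_slab"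
      by (intro image_closure_subset) (auto intro: closure_subset[THEN subsetD])
    moreover have "p = g 0" "(0::real) \<in> closure {0<..1}" by (auto simp: g_def xh)
    ultimately show "p \<in> closure open_slab" by blast
  qed
qed

lemma fst_closed_slab: "fst ` closed_slab = cell {i, j}"
proof (intro equalityI subsetI)
  fix x assume x: "x \<in> cell {i, j}"
  then have "tilt i j a b x \<le> tilt i j a' b' x"
    using ij aa' bb' by (intro tilt_mono) (auto simp: cell_pair_iff)
  then have "(x, tilt i j a b x) \<in> closed_slab" using x by (simp add: closed_slab_def)
  then show "x \<in> fst ` closed_slab" by force
qed (auto simp: closed_slab_def)

text \<open>
  Two positive coordinates already force a point of the whole realization into the open edge, so
  other edges that meet at the ends of this one do not interfere.
\<close>

lemma open_slab_open_in_realization: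
  assumes "{i, j} \<in> E" and "\<And>e. e \<in> E \<Longrightarrow> card e = 2"
  shows "\<exists>U. open U \<and> (realization V E \<times> UNIV) \<inter> U = open_slab"
proof (intro exI conjI)
  let ?U = "{p. 0 < fst p i} \<inter> {p. 0 < fst p j} \<inter> {p. tilt i j a b (fst p) < snd p}
      \<inter> {p. snd p < tilt i j a' b' (fst p)} :: ((nat \<Rightarrow> real) \<times> real) set"
  show "open ?U"
    by (intro open_Int open_Collect_less continuous_on_tilt continuous_on_fst_coordinate
        continuous_intros)
  have *: "x \<in> cell {i, j}" if "x \<in> realization V E" and pos: "0 < x i" "0 < x j" for x
  proof -
    from that obtain e where e: "x \<in> cell e" "e \<in> E \<or> (\<exists>v. e = {v})"
      by (auto simp: realization_def)
    have "{i, j} \<subseteq> e" using e(1) pos by (auto simp: cell_def)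
    then have "e = {i, j}"
      using e(2) assms(2) ij by (metis card_2_iff card_subset_eq card_gt_0_iff subset_singletonD
          doubleton_eq_iff insert_not_empty singleton_insert_inj_eq zero_less_numeral)
    then show ?thesis using e by simp
  qed
  show "(realization V E \<times> UNIV) \<inter> ?U = open_slab"
  proof (intro equalityI subsetI)
    fix p assume p: "p \<in> (realization V E \<times> UNIV) \<inter> ?U"
    then have "fst p \<in> cell {i, j}" using * by auto
    then show "p \<in> open_slab" using p by (auto simp: open_slab_def)
  qed (use assms(1) in \<open>auto simp: open_slab_def realization_def\<close>)
qed

lemma closed_slab_in_realization: "{i, j} \<in> E \<Longrightarrow> closed_slab \<subseteq> realization V E \<times> UNIV"
  by (auto simp: closed_slab_def realization_def)

lemma frontier_of_open_slab:
  assumes "{i, j} \<in> E" and "\<And>e. e \<in> E \<Longrightarrow> card e = 2"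
  shows "top_of_set (realization V E \<times> UNIV) frontier_of open_slab = closed_slab - open_slab"
proof -
  let ?R = "realization V E \<times> (UNIV :: real set)"
  have "openin (top_of_set ?R) open_slab"
    using open_slab_open_in_realization[OF assms] unfolding openin_open by metis
  then have "top_of_set ?R interior_of open_slab = open_slab" by (simp add: interior_of_openin)
  moreover have "open_slab \<subseteq> ?R"
    using closed_slab_in_realization[OF assms(1)] open_subset_closed_slab by blast
  then have "top_of_set ?R closure_of open_slab = closed_slab"
    using closed_slab_in_realization[OF assms(1)]
    by (auto simp: closure_of_subtopology closure_open_slab Int_absorb1)
  ultimately show ?thesis by (simp add: frontier_of_def)
qed

text \<open>
  If the complement X contains the open slab but no other point of the closed slab, then the slab
  is both open and closed in every subset of X containing it, so no larger one is connected.
\<close>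

lemma open_slab_component:
  assumes "{i, j} \<in> E" and "\<And>e. e \<in> E \<Longrightarrow> card e = 2"
    and X: "X \<subseteq> realization V E \<times> UNIV" "open_slab \<subseteq> X" "X \<inter> closed_slab \<subseteq> open_slab"
  shows "open_slab \<in> components X"
proof -
  have "D = open_slab" if D: "open_slab \<subseteq> D" "D \<subseteq> X" "connected D" for D
  proof -
    obtain U where U: "open U" "(realization V E \<times> UNIV) \<inter> U = open_slab"
      using open_slab_open_in_realization[OF assms(1,2)] by blast
    have "D \<inter> U = open_slab" "D \<inter> closed_slab = open_slab"
      using U D X open_subset_closed_slab by blast+
    then have "openin (top_of_set D) open_slab" "closedin (top_of_set D) open_slab"
      using U closed_closed_slab by (metis openin_open, metis closedin_closed)
    then show ?thesis using D open_slab_point by (metis connected_clopen empty_iff)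
  qed
  then show ?thesis
    using open_slab_point X connected_open_slab by (subst in_components_maximal) blast
qed

end

section \<open>The quiver of a double word\<close>

lemma hd_filter_least:
  assumes "m < length xs" "P (xs ! m)" "\<And>k. k < m \<Longrightarrow> \<not> P (xs ! k)"
  shows "filter P xs \<noteq> []" "hd (filter P xs) = xs ! m"
proof -
  have "filter P (take m xs) = []" using assms by (auto simp: filter_empty_conv in_set_conv_nth)
  moreover have "xs = take m xs @ xs ! m # drop (Suc m) xs" using assms(1) by (rule id_take_nth_drop)
  ultimately have "filter P xs = xs ! m # filter P (drop (Suc m) xs)"
    using assms(2) by (metis append_Nil filter.simps(2) filter_append)
  then show "filter P xs \<noteq> []" "hd (filter P xs) = xs ! m" by auto
qed

lemma last_filter_greatest:
  assumes "m < length xs" "P (xs ! m)" "\<And>k. m < k \<Longrightarrow> k < length xs \<Longrightarrow> \<not> P (xs ! k)"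
  shows "last (filter P xs) = xs ! m"
proof -
  have "filter P (drop (Suc m) xs) = []" using assms by (auto simp: filter_empty_conv in_set_conv_nth)
  moreover have "xs = take m xs @ xs ! m # drop (Suc m) xs" using assms(1) by (rule id_take_nth_drop)
  ultimately have "filter P xs = filter P (take m xs) @ [xs ! m]"
    using assms(2) by (metis filter.simps(2) filter_append)
  then show ?thesis by simp
qed

lemma bfz_quiver_simps:
  "verts (bfz_quiver r A w) = index_set r w"
  "tail (bfz_quiver r A w) = arrow_tail" "head (bfz_quiver r A w) = arrow_head"
  by (simp_all add: bfz_quiver_def)

text \<open>
  The conditions under which the quiver of a word is a dimer quiver. Reducedness enters only as
  \<open>separated\<close>: between two consecutive occurrences of a letter, with no letter of the same
  absolute value between them, there is a letter of the same sign at an adjacent vertex.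
\<close>

locale double_word =
  fixes r :: nat and A :: "nat \<Rightarrow> nat \<Rightarrow> int" and w :: "int list"
  assumes letters: "\<And>c. c \<in> set w \<Longrightarrow> c \<noteq> 0 \<and> nat \<bar>c\<bar> \<in> {1..r}"
    and adjacent_sym: "\<And>i j. i \<in> {1..r} \<Longrightarrow> j \<in> {1..r} \<Longrightarrow> i \<noteq> j \<Longrightarrow> A i j < 0 \<longleftrightarrow> A j i < 0"
    and diagonal: "\<And>i. i \<in> {1..r} \<Longrightarrow> 0 \<le> A i i"
    and separated: "\<And>a c m b. w = a @ c # m @ c # b \<Longrightarrow> c \<notin> set m \<Longrightarrow> - c \<notin> set m \<Longrightarrow>
      \<exists>d\<in>set m. sgn d = sgn c \<and> A (nat \<bar>c\<bar>) (nat \<bar>d\<bar>) < 0"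
begin

abbreviation "N \<equiv> int (length w)"
abbreviation "I \<equiv> index_set r w"
abbreviation "st \<equiv> bfz_strand w"
abbreviation "nx \<equiv> next_index r w"
abbreviation "ht \<equiv> bfz_height r w"
abbreviation "E \<equiv> dynkin_edges r A"

subsection \<open>Indices and heights\<close>

lemma finite_I: "finite I"
  by (simp add: index_set_def)

lemma letter_pos: "l \<in> {1..N} \<Longrightarrow> letter w l \<in> set w"
  by (auto simp: letter_def)

lemma letter_nonzero: "l \<in> {1..N} \<Longrightarrow> letter w l \<noteq> 0"
  using letter_pos letters by blast

lemma st_neg: "i \<in> {1..r} \<Longrightarrow> st (- int i) = i"
  by (auto simp: bfz_strand_def letter_def)

lemma neg_in_I: "i \<in> {1..r} \<Longrightarrow> - int i \<in> I"
  by (auto simp: index_set_def)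

lemma pos_in_I: "l \<in> {1..N} \<Longrightarrow> l \<in> I"
  by (auto simp: index_set_def)

lemma I_cases: "k \<in> I \<Longrightarrow> k \<in> {1..N} \<or> k < 0 \<and> k = - int (st k)"
  by (auto simp: index_set_def bfz_strand_def letter_def)

lemma st_in: "k \<in> I \<Longrightarrow> st k \<in> {1..r}"
proof -
  assume k: "k \<in> I"
  show ?thesis
  proof (cases "k \<in> {1..N}")
    case True
    then show ?thesis using letter_pos letters by (simp add: bfz_strand_def)
  next
    case False
    then show ?thesis using k by (auto simp: index_set_def bfz_strand_def letter_def)
  qed
qed

lemma edge_iff: "{i, j} \<in> E \<longleftrightarrow> i \<in> {1..r} \<and> j \<in> {1..r} \<and> i \<noteq> j \<and> A i j < 0"
  using adjacent_sym by (auto simp: dynkin_edges_def doubleton_eq_iff)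

lemma edge_cases: "e \<in> E \<Longrightarrow> \<exists>i j. e = {i, j} \<and> i \<in> {1..r} \<and> j \<in> {1..r} \<and> i \<noteq> j"
  by (auto simp: dynkin_edges_def)

lemma edge_card: "e \<in> E \<Longrightarrow> card e = 2"
  using edge_cases by fastforce

lemma height_less: "k \<in> I \<Longrightarrow> l \<in> I \<Longrightarrow> k < l \<Longrightarrow> ht k < ht l"
proof -
  assume kl: "k \<in> I" "l \<in> I" "k < l"
  then have "{m \<in> I. m \<le> k} \<subseteq> {m \<in> I. m \<le> l}" "l \<in> {m \<in> I. m \<le> l} - {m \<in> I. m \<le> k}" by auto
  then have "{m \<in> I. m \<le> k} \<subset> {m \<in> I. m \<le> l}" by blast
  then show ?thesis
    unfolding bfz_height_def using finite_I by (simp add: psubset_card_mono)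
qed

lemma height_less_iff: "k \<in> I \<Longrightarrow> l \<in> I \<Longrightarrow> ht k < ht l \<longleftrightarrow> k < l"
  using height_less by (metis less_asym linorder_neqE)

lemma height_le_iff: "k \<in> I \<Longrightarrow> l \<in> I \<Longrightarrow> ht k \<le> ht l \<longleftrightarrow> k \<le> l"
  using height_less_iff by (metis leD leI)

lemma height_eq_iff: "k \<in> I \<Longrightarrow> l \<in> I \<Longrightarrow> ht k = ht l \<longleftrightarrow> k = l"
  using height_le_iff by (metis order.antisym order_refl)

lemma height_pos: "k \<in> I \<Longrightarrow> 0 < ht k"
  unfolding bfz_height_def using finite_I by (auto simp: card_gt_0_iff)

subsection \<open>Vertical arrows\<close>

text \<open>
  The topmost vertex on string i once the letters up to position s are read; the index
  \<open>- i\<close> ensures that there is one as soon as \<open>0 \<le> s\<close>.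
\<close>

definition latest :: "nat \<Rightarrow> int \<Rightarrow> int" where
  "latest i s = Max {k \<in> I. k \<le> s \<and> st k = i}"

lemma latest:
  assumes "i \<in> {1..r}" "0 \<le> s"
  shows "latest i s \<in> I" "latest i s \<le> s" "st (latest i s) = i"
proof -
  have "- int i \<in> {k \<in> I. k \<le> s \<and> st k = i}" using assms by (auto simp: neg_in_I st_neg)
  then have "latest i s \<in> {k \<in> I. k \<le> s \<and> st k = i}"
    unfolding latest_def using finite_I by (intro Max_in) auto
  then show "latest i s \<in> I" "latest i s \<le> s" "st (latest i s) = i" by auto
qed

lemma latest_greatest: "k \<in> I \<Longrightarrow> k \<le> s \<Longrightarrow> st k = i \<Longrightarrow> k \<le> latest i s"
  unfolding latest_def using finite_I by (intro Max_ge) auto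

lemma latest_eqI:
  assumes "k \<in> I" "k \<le> s" "st k = i" "\<And>l. l \<in> I \<Longrightarrow> k < l \<Longrightarrow> l \<le> s \<Longrightarrow> st l \<noteq> i"
  shows "latest i s = k"
  unfolding latest_def using assms finite_I by (intro Max_eqI) (auto simp: not_less[symmetric])

lemma latest_mono: "i \<in> {1..r} \<Longrightarrow> 0 \<le> s \<Longrightarrow> s \<le> s' \<Longrightarrow> latest i s \<le> latest i s'"
  using latest[of i s] by (intro latest_greatest) auto

lemma latest_self: "l \<in> {1..N} \<Longrightarrow> latest (st l) l = l"
  by (intro latest_eqI) (auto simp: pos_in_I)

lemma latest_zero: "i \<in> {1..r} \<Longrightarrow> latest i 0 = - int i"
  using I_cases by (intro latest_eqI) (fastforce simp: neg_in_I st_neg)+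

lemma latest_constant:
  assumes "i \<in> {1..r}" "0 \<le> s" "s \<le> s'" "\<And>l. l \<in> {1..N} \<Longrightarrow> s < l \<Longrightarrow> l \<le> s' \<Longrightarrow> st l \<noteq> i"
  shows "latest i s' = latest i s"
proof (rule latest_eqI)
  fix l assume l: "l \<in> I" "latest i s < l" "l \<le> s'"
  show "st l \<noteq> i"
  proof
    assume i: "st l = i"
    then have "s < l" using l latest_greatest[of l s i] by (meson leD leI)
    then have "l \<in> {1..N}" using l assms(2) I_cases[of l] by auto
    then show False using assms(4) l i \<open>s < l\<close> by blast
  qed
qed (use latest[OF assms(1,2)] assms in auto)

lemma last_index_eq: "i \<in> {1..r} \<Longrightarrow> last_index r w i = latest i N"
  unfolding last_index_def latest_def by (rule arg_cong[of _ _ Max]) (auto simp: index_set_def)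

abbreviation "prv l \<equiv> latest (st l) (l - 1)"

lemma prv:
  assumes "l \<in> {1..N}"
  shows "prv l \<in> I" "prv l < l" "st (prv l) = st l"
  using latest[of "st l" "l - 1"] st_in[OF pos_in_I[OF assms]] assms by auto

lemma prv_le_latest:
  assumes "l \<in> {1..N}" "0 \<le> s" "s < l"
  shows "latest (st l) s \<le> prv l"
  using assms st_in[OF pos_in_I] by (intro latest_mono) auto

lemma next_index:
  assumes "k \<in> I"
  shows "k < nx k" "1 \<le> nx k" "nx k \<le> N + 1" "nx k \<le> N \<Longrightarrow> st (nx k) = st k"
    and "\<And>l. l \<in> I \<Longrightarrow> k < l \<Longrightarrow> st l = st k \<Longrightarrow> nx k \<le> l"
proof -
  let ?S = "{l \<in> I. k < l \<and> st l = st k}"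
  have fin: "finite ?S" using finite_I by simp
  have eq: "nx k = (if ?S = {} then N + 1 else Min ?S)" by (simp add: next_index_def Let_def)
  have in_S: "l \<in> {1..N}" if "l \<in> ?S" for l
    using that I_cases[of l] I_cases[of k] assms by auto
  show "\<And>l. l \<in> I \<Longrightarrow> k < l \<Longrightarrow> st l = st k \<Longrightarrow> nx k \<le> l"
    using eq fin by (auto intro: Min_le)
  have "nx k \<in> ?S \<or> ?S = {} \<and> nx k = N + 1" using Min_in[OF fin] eq by auto
  then have "nx k \<in> ?S \<and> nx k \<in> {1..N} \<or> nx k = N + 1" using in_S by blast
  then show "k < nx k" "1 \<le> nx k" "nx k \<le> N + 1" "nx k \<le> N \<Longrightarrow> st (nx k) = st k"
    using I_cases[OF assms] by auto
qed

lemma next_prv: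
  assumes "l \<in> {1..N}"
  shows "nx (prv l) = l"
proof -
  note p = prv[OF assms] and n = next_index[OF prv(1)[OF assms]]
  have "nx (prv l) \<le> l" using n(5) p pos_in_I[OF assms] by auto
  moreover have "\<not> nx (prv l) < l"
  proof
    assume "nx (prv l) < l"
    moreover from this have "nx (prv l) \<in> I" "st (nx (prv l)) = st l"
      using n p assms by (auto intro!: pos_in_I)
    ultimately show False using n(1) latest_greatest[of "nx (prv l)" "l - 1" "st l"] by auto
  qed
  ultimately show ?thesis by simp
qed

lemma prv_next:
  assumes "k \<in> I" "nx k \<le> N"
  shows "nx k \<in> {1..N}" "prv (nx k) = k"
proof -
  note n = next_index[OF assms(1)]
  show "nx k \<in> {1..N}" using n assms by auto
  show "prv (nx k) = k"
    using n assms by (intro latest_eqI) force+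
qed

definition vertical_arrow :: "int \<Rightarrow> bfz_arrow" where
  "vertical_arrow l = (if letter w l > 0 then Vertical (prv l) l else Vertical l (prv l))"

text \<open>
  Each vertical arrow is indexed by its upper vertex, which is always a letter of the word.
\<close>

lemma vertical_arrows_eq: "vertical_arrows r w = vertical_arrow ` {1..N}"
proof (intro equalityI subsetI)
  fix a assume "a \<in> vertical_arrows r w"
  then obtain k where k: "k \<in> I" "nx k \<le> N"
    "a = (if letter w (nx k) > 0 then Vertical k (nx k) else Vertical (nx k) k)"
    by (auto simp: vertical_arrows_def)
  then have "a = vertical_arrow (nx k)" using prv_next[OF k(1,2)] by (simp add: vertical_arrow_def)
  then show "a \<in> vertical_arrow ` {1..N}" using prv_next[OF k(1,2)] by blast
next
  fix a assume "a \<in> vertical_arrow ` {1..N}"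
  then obtain l where l: "l \<in> {1..N}" "a = vertical_arrow l" by blast
  then show "a \<in> vertical_arrows r w"
    unfolding vertical_arrows_def vertical_arrow_def mem_Collect_eq
    using prv[OF l(1)] next_prv[OF l(1)]
    by (intro exI[of _ "prv l"] exI[of _ l]) auto
qed

subsection \<open>Slanted arrows as cuts of a strip\<close>

definition positions :: "nat \<Rightarrow> nat \<Rightarrow> int set" where
  "positions i j = {l \<in> {1..N}. st l \<in> {i, j}}"

text \<open>
  For a position l of the strip \<open>{i, j}\<close> this says that the vertical arrow below l points up
  if it lies over j and points down if it lies over i. Interchanging i and j negates it.
\<close>

definition upward :: "nat \<Rightarrow> int \<Rightarrow> bool" where
  "upward j l \<longleftrightarrow> (0 < letter w l \<longleftrightarrow> st l = j)"

text \<open>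
  The positions after which a slanted arrow of the strip is drawn: the bottom, the top, and every
  position whose successor in the strip is directed the other way.
\<close>

definition cuts :: "nat \<Rightarrow> nat \<Rightarrow> int set" where
  "cuts i j = (if positions i j = {} then {} else {0, Max (positions i j)} \<union>
     {s \<in> positions i j. \<exists>m\<in>positions i j. s < m \<and> {s<..<m} \<inter> positions i j = {} \<and>
        upward j s \<noteq> upward j m})"

text \<open>
  The slanted arrow drawn after position s, between the two vertices that are topmost at that
  moment. At the bottom no letter precedes, and the arrow is opposite to what the first letter would
  prescribe if it were the last letter below the arrow.
\<close>

definition cut_arrow :: "nat \<Rightarrow> nat \<Rightarrow> int \<Rightarrow> bfz_arrow" where
  "cut_arrow i j s =
    (if s = 0 then
       if upward j (Min (positions i j)) then Bottom (latest i s) (latest j s)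
       else Bottom (latest j s) (latest i s)
     else if s = Max (positions i j) then
       if upward j s then Top (latest j s) (latest i s) else Top (latest i s) (latest j s)
     else
       if upward j s then Inclined (latest j s) (latest i s)
       else Inclined (latest i s) (latest j s))"

lemma finite_positions: "finite (positions i j)"
  by (rule finite_subset[of _ "{1..N}"]) (auto simp: positions_def)

lemma positions_commute: "positions i j = positions j i"
  by (auto simp: positions_def)

lemma upward_swap: "i \<noteq> j \<Longrightarrow> l \<in> positions i j \<Longrightarrow> upward i l \<longleftrightarrow> \<not> upward j l"
  by (auto simp: upward_def positions_def)

lemma cuts_commute_le: "i \<noteq> j \<Longrightarrow> cuts i j \<subseteq> cuts j i"
proof
  fix s assume ij: "i \<noteq> j" and s: "s \<in> cuts i j"
  have "upward i l \<noteq> upward i m" if "upward j l \<noteq> upward j m" "l \<in> positions i j" "m \<in> positions i j" for l m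
    using upward_swap[OF ij] that by blast
  then show "s \<in> cuts j i"
    using s unfolding cuts_def positions_commute[of j i] by (auto split: if_splits)
qed

lemma cuts_commute: "i \<noteq> j \<Longrightarrow> cuts i j = cuts j i"
  by (intro equalityI cuts_commute_le) simp_all

lemma cuts_cases: "s \<in> cuts i j \<Longrightarrow> s = 0 \<or> s \<in> positions i j"
  using Max_in[OF finite_positions] by (auto simp: cuts_def split: if_splits)

lemma cuts_nonneg: "s \<in> cuts i j \<Longrightarrow> 0 \<le> s"
  using cuts_cases by (fastforce simp: positions_def)

lemma cuts_le_Max: "s \<in> cuts i j \<Longrightarrow> s \<le> Max (positions i j)"
proof -
  assume s: "s \<in> cuts i j"
  then have "positions i j \<noteq> {}" by (auto simp: cuts_def)
  then have "Max (positions i j) \<in> positions i j" by (intro Max_in finite_positions)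
  then have "0 \<le> Max (positions i j)" by (auto simp: positions_def)
  then show ?thesis using cuts_cases[OF s] Max_ge[OF finite_positions] by auto
qed

lemma finite_cuts: "finite (cuts i j)"
  by (rule finite_subset[of _ "insert 0 (positions i j)"]) (use cuts_cases finite_positions in blast)+

lemma extreme_cuts: "positions i j \<noteq> {} \<Longrightarrow> 0 \<in> cuts i j \<and> Max (positions i j) \<in> cuts i j"
  by (simp add: cuts_def)

lemma cut_arrow_commute:
  assumes "i \<noteq> j" "s \<in> cuts i j"
  shows "cut_arrow j i s = cut_arrow i j s"
proof -
  have ne: "positions i j \<noteq> {}" using assms by (auto simp: cuts_def)
  have "s = 0 \<or> upward i s = (\<not> upward j s)" using upward_swap assms cuts_cases by blast
  moreover have "upward i (Min (positions i j)) = (\<not> upward j (Min (positions i j)))"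
    using upward_swap assms Min_in[OF finite_positions ne] by blast
  ultimately show ?thesis by (auto simp: cut_arrow_def positions_commute[of j i])
qed

lemma cut_arrow_ends:
  "{arrow_tail (cut_arrow i j s), arrow_head (cut_arrow i j s)} = {latest i s, latest j s}"
  by (auto simp: cut_arrow_def)

lemma latest_positions:
  assumes "i \<in> {1..r}" "j \<in> {1..r}" "s \<in> positions i j"
  shows "s = max (latest i s) (latest j s)"
proof -
  have s: "s \<in> {1..N}" "st s = i \<or> st s = j" using assms(3) by (auto simp: positions_def)
  then have "latest i s \<le> s" "latest j s \<le> s" using latest assms(1,2) by auto
  then show ?thesis using s latest_self[OF s(1)] by auto
qed

text \<open>
  A cut is the larger of its two vertices, or 0 if both of them are negative.
\<close>

lemma latest_cuts_inj:
  assumes "i \<in> {1..r}" "j \<in> {1..r}" "s \<in> cuts i j" "s' \<in> cuts i j"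
    "latest i s = latest i s'" "latest j s = latest j s'"
  shows "s = s'"
proof -
  have *: "s = max 0 (max (latest i s) (latest j s))" if "s \<in> cuts i j" for s
  proof (cases "s = 0")
    case True
    then show ?thesis using latest_zero assms(1,2) by simp
  next
    case False
    then have s: "s \<in> positions i j" using cuts_cases[OF that] by blast
    then have "0 \<le> s" by (auto simp: positions_def)
    then show ?thesis using latest_positions[OF assms(1,2) s] by simp
  qed
  show ?thesis using *[OF assms(3)] *[OF assms(4)] assms(5,6) by simp
qed

lemma edge_letters:
  assumes "i \<in> {1..r}" "j \<in> {1..r}"
  shows "edge_letters w i j \<noteq> [] \<longleftrightarrow> positions i j \<noteq> {}"
    and "positions i j \<noteq> {} \<Longrightarrow> hd (edge_letters w i j) = letter w (Min (positions i j))"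
    and "positions i j \<noteq> {} \<Longrightarrow> last (edge_letters w i j) = letter w (Max (positions i j))"
proof -
  let ?p = "\<lambda>x :: int. nat \<bar>x\<bar> \<in> {i, j}"
  have pos: "int k + 1 \<in> positions i j \<longleftrightarrow> k < length w \<and> ?p (w ! k)" for k
    by (auto simp: positions_def bfz_strand_def letter_def nat_add_distrib)
  have pos': "l \<in> positions i j \<Longrightarrow> l = int (nat l - 1) + 1" for l
    by (auto simp: positions_def)
  show "edge_letters w i j \<noteq> [] \<longleftrightarrow> positions i j \<noteq> {}"
  proof -
    have "edge_letters w i j \<noteq> [] \<longleftrightarrow> (\<exists>k. k < length w \<and> ?p (w ! k))"
      unfolding edge_letters_def filter_empty_conv by (metis in_set_conv_nth)
    also have "\<dots> \<longleftrightarrow> (\<exists>k. int k + 1 \<in> positions i j)" using pos by simp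
    also have "\<dots> \<longleftrightarrow> positions i j \<noteq> {}" using pos' by (metis all_not_in_conv)
    finally show ?thesis .
  qed
  assume ne: "positions i j \<noteq> {}"
  define m where "m = nat (Min (positions i j)) - 1"
  have m: "int m + 1 = Min (positions i j)"
    using pos'[OF Min_in[OF finite_positions ne]] by (simp add: m_def)
  have "\<not> ?p (w ! k)" if "k < m" for k
    using pos[of k] pos[of m] that m Min_le[OF finite_positions, of "int k + 1" i j]
      Min_in[OF finite_positions ne] by auto
  then have "hd (edge_letters w i j) = w ! m"
    unfolding edge_letters_def using pos[of m] m Min_in[OF finite_positions ne]
    by (intro hd_filter_least) auto
  then show "hd (edge_letters w i j) = letter w (Min (positions i j))"
    by (simp add: letter_def nat_add_distrib flip: m)
  define M where "M = nat (Max (positions i j)) - 1"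
  have M: "int M + 1 = Max (positions i j)"
    using pos'[OF Max_in[OF finite_positions ne]] by (simp add: M_def)
  have "\<not> ?p (w ! k)" if "M < k" "k < length w" for k
    using pos[of k] that M Max_ge[OF finite_positions, of "int k + 1" i j] by auto
  then have "last (edge_letters w i j) = w ! M"
    unfolding edge_letters_def using pos[of M] M Max_in[OF finite_positions ne]
    by (intro last_filter_greatest) auto
  then show "last (edge_letters w i j) = letter w (Max (positions i j))"
    by (simp add: letter_def nat_add_distrib flip: M)
qed


lemma st_letter: "st l = nat \<bar>letter w l\<bar>"
  by (simp add: bfz_strand_def)

text \<open>
  The definition of the boundary arrows orders an edge by its first letter, whereas the cut arrow
  does not depend on the order; this is where the two conventions are matched.
\<close>

lemma bottom_arrows_eq:
  "bottom_arrows r A w = {cut_arrow i j 0 | i j. {i, j} \<in> E \<and> positions i j \<noteq> {}}"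
proof -
  have *: "cut_arrow i j 0 = (if hd (edge_letters w i j) > 0 then Bottom (- int i) (- int j)
      else Bottom (- int j) (- int i))"
    if "{i, j} \<in> E" "positions i j \<noteq> {}" "nat \<bar>hd (edge_letters w i j)\<bar> = j" for i j
    using that edge_letters(2)[of i j] latest_zero[of i] latest_zero[of j]
    by (simp add: cut_arrow_def upward_def st_letter edge_iff)
  show ?thesis
  proof (intro equalityI subsetI)
    fix a assume "a \<in> bottom_arrows r A w"
    then obtain i j where ij: "{i, j} \<in> E" "edge_letters w i j \<noteq> []"
      "nat \<bar>hd (edge_letters w i j)\<bar> = j"
      "a = (if hd (edge_letters w i j) > 0 then Bottom (- int i) (- int j)
        else Bottom (- int j) (- int i))"
      unfolding bottom_arrows_def by blast
    then have "positions i j \<noteq> {}" using edge_letters(1)[of i j] edge_iff by blast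
    moreover from this have "a = cut_arrow i j 0" using *[of i j] ij by simp
    ultimately show "a \<in> {cut_arrow i j 0 | i j. {i, j} \<in> E \<and> positions i j \<noteq> {}}"
      using ij(1) by blast
  next
    fix a assume "a \<in> {cut_arrow i j 0 | i j. {i, j} \<in> E \<and> positions i j \<noteq> {}}"
    then obtain i j where ij: "{i, j} \<in> E" "positions i j \<noteq> {}" "a = cut_arrow i j 0" by blast
    have in_b: "cut_arrow i j 0 \<in> bottom_arrows r A w"
      if "{i, j} \<in> E" "positions i j \<noteq> {}" "st (Min (positions i j)) = j" for i j
    proof -
      have "edge_letters w i j \<noteq> []" "nat \<bar>hd (edge_letters w i j)\<bar> = j"
        using that edge_letters[of i j] by (auto simp: edge_iff st_letter)
      then show ?thesis unfolding bottom_arrows_def mem_Collect_eq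
        using *[OF that(1,2)] that(1) by (intro exI[of _ i] exI[of _ j] conjI)
    qed
    have "st (Min (positions i j)) \<in> {i, j}"
      using Min_in[OF finite_positions ij(2)] by (auto simp: positions_def)
    then consider "st (Min (positions i j)) = j" | "st (Min (positions i j)) = i" by blast
    then show "a \<in> bottom_arrows r A w"
    proof cases
      case 1
      then show ?thesis using in_b ij by blast
    next
      case 2
      then have "cut_arrow j i 0 \<in> bottom_arrows r A w"
        using in_b[of j i] ij by (simp add: insert_commute positions_commute[of j i])
      moreover have "cut_arrow j i 0 = cut_arrow i j 0"
        using ij extreme_cuts edge_iff by (intro cut_arrow_commute) auto
      ultimately show ?thesis using ij(3) by simp
    qed
  qed
qed

lemma latest_Max:
  assumes "i \<in> {1..r}" "j \<in> {1..r}" "positions i j \<noteq> {}"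
  shows "latest i N = latest i (Max (positions i j))" "latest j N = latest j (Max (positions i j))"
    and "0 < Max (positions i j)"
proof -
  have M: "Max (positions i j) \<in> {1..N}"
    using Max_in[OF finite_positions assms(3)] by (auto simp: positions_def)
  have "st l \<noteq> i \<and> st l \<noteq> j" if "l \<in> {1..N}" "Max (positions i j) < l" for l
    using that Max_ge[OF finite_positions, of l i j] by (auto simp: positions_def)
  then show "latest i N = latest i (Max (positions i j))" "latest j N = latest j (Max (positions i j))"
    using M assms(1,2) by (auto intro!: latest_constant)
  show "0 < Max (positions i j)" using M by simp
qed

lemma top_arrows_eq:
  "top_arrows r A w = {cut_arrow i j (Max (positions i j)) | i j. {i, j} \<in> E \<and> positions i j \<noteq> {}}"
proof -
  have *: "cut_arrow i j (Max (positions i j)) =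
      (if last (edge_letters w i j) > 0 then Top (last_index r w j) (last_index r w i)
       else Top (last_index r w i) (last_index r w j))"
    if "{i, j} \<in> E" "positions i j \<noteq> {}" "nat \<bar>last (edge_letters w i j)\<bar> = j" for i j
    using that edge_letters(3)[of i j] latest_Max[of i j] last_index_eq[of i] last_index_eq[of j]
    by (simp add: cut_arrow_def upward_def st_letter edge_iff)
  show ?thesis
  proof (intro equalityI subsetI)
    fix a assume "a \<in> top_arrows r A w"
    then obtain i j where ij: "{i, j} \<in> E" "edge_letters w i j \<noteq> []"
      "nat \<bar>last (edge_letters w i j)\<bar> = j"
      "a = (if last (edge_letters w i j) > 0 then Top (last_index r w j) (last_index r w i)
       else Top (last_index r w i) (last_index r w j))"
      unfolding top_arrows_def by blast
    then have "positions i j \<noteq> {}" using edge_letters(1)[of i j] edge_iff by blast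
    moreover from this have "a = cut_arrow i j (Max (positions i j))" using *[of i j] ij by simp
    ultimately show "a \<in> {cut_arrow i j (Max (positions i j)) | i j. {i, j} \<in> E \<and> positions i j \<noteq> {}}"
      using ij(1) by blast
  next
    fix a assume "a \<in> {cut_arrow i j (Max (positions i j)) | i j. {i, j} \<in> E \<and> positions i j \<noteq> {}}"
    then obtain i j where ij: "{i, j} \<in> E" "positions i j \<noteq> {}"
      "a = cut_arrow i j (Max (positions i j))" by blast
    have in_b: "cut_arrow i j (Max (positions i j)) \<in> top_arrows r A w"
      if "{i, j} \<in> E" "positions i j \<noteq> {}" "st (Max (positions i j)) = j" for i j
    proof -
      have "edge_letters w i j \<noteq> []" "nat \<bar>last (edge_letters w i j)\<bar> = j"
        using that edge_letters[of i j] by (auto simp: edge_iff st_letter)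
      then show ?thesis unfolding top_arrows_def mem_Collect_eq
        using *[OF that(1,2)] that(1) by (intro exI[of _ i] exI[of _ j] conjI)
    qed
    have "st (Max (positions i j)) \<in> {i, j}"
      using Max_in[OF finite_positions ij(2)] by (auto simp: positions_def)
    then consider "st (Max (positions i j)) = j" | "st (Max (positions i j)) = i" by blast
    then show "a \<in> top_arrows r A w"
    proof cases
      case 1
      then show ?thesis using in_b ij by blast
    next
      case 2
      then have "cut_arrow j i (Max (positions i j)) \<in> top_arrows r A w"
        using in_b[of j i] ij by (simp add: insert_commute positions_commute[of j i])
      moreover have "cut_arrow j i (Max (positions i j)) = cut_arrow i j (Max (positions i j))"
        using ij extreme_cuts edge_iff by (intro cut_arrow_commute) auto
      ultimately show ?thesis using ij(3) by simp
    qed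
  qed
qed

text \<open>
  The upper end l of an inclined arrow is a letter, and its lower end k is the latest vertex on the
  other string. The successor m of l in the strip is the smaller of the next indices of k and of l.
  In the first case of the definition m lies on the string of k and has the sign of l, in the second
  it lies on the string of l and has the opposite sign: either way l and m have opposite
  directions, and these are all the possibilities.
\<close>

lemma inclined_arrows_eq:
  "inclined_arrows r A w =
    {cut_arrow i j s | i j s. {i, j} \<in> E \<and> s \<in> cuts i j \<and> s \<noteq> 0 \<and> s \<noteq> Max (positions i j)}"
    (is "_ = ?R")
proof (intro equalityI subsetI)
  fix a assume "a \<in> inclined_arrows r A w"
  then obtain k l where a: "a = (if letter w l < 0 then Inclined k l else Inclined l k)"
    and kl: "k \<in> I" "l \<in> I" "k < l" "1 \<le> l" "A (st k) (st l) < 0"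
    and c: "l < nx k \<and> nx k < nx l \<and> sgn (letter w l) = sgn (letter w (nx k)) \<or>
       l < nx l \<and> nx l < nx k \<and> sgn (letter w l) = - sgn (letter w (nx l))"
    unfolding inclined_arrows_def by blast
  define i j where "i = st k" and "j = st l"
  have l: "l \<in> {1..N}" using kl I_cases by fastforce
  have r: "i \<in> {1..r}" "j \<in> {1..r}" using kl st_in by (auto simp: i_def j_def)
  have "i \<noteq> j" using kl(5) diagonal[OF r(1)] by (auto simp: i_def j_def)
  then have ij: "i \<noteq> j" "{i, j} \<in> E" using kl r by (auto simp: edge_iff i_def j_def)
  note nk = next_index[OF kl(1)] and nl = next_index[OF kl(2)]
  have "l < nx k" using c by auto
  then have "st p \<noteq> i" if "p \<in> I" "k < p" "p \<le> l" for p
    using nk(5)[of p] that by (auto simp: i_def)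
  then have top: "latest i l = k" "latest j l = l"
    using kl latest_self[OF l] by (auto simp: i_def j_def intro!: latest_eqI)
  obtain m where m: "m \<in> positions i j" "l < m" "m \<le> nx k" "m \<le> nx l" "upward j l \<noteq> upward j m"
  proof (cases "nx k < nx l")
    case True
    then have m: "nx k \<in> {1..N}" "st (nx k) = i" using nk nl by (auto simp: i_def)
    moreover from this have "upward j l \<noteq> upward j (nx k)"
      using c True ij letter_nonzero[OF l] letter_nonzero[OF m(1)]
      by (auto simp: upward_def j_def[symmetric] sgn_if split: if_splits)
    ultimately show ?thesis using that[of "nx k"] \<open>l < nx k\<close> True by (auto simp: positions_def)
  next
    case False
    then have lt: "nx l < nx k" "sgn (letter w l) = - sgn (letter w (nx l))" using c by auto
    then have m: "nx l \<in> {1..N}" "st (nx l) = j" using nk nl by (auto simp: j_def)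
    moreover from this have "upward j l \<noteq> upward j (nx l)"
      using lt(2) ij letter_nonzero[OF l] letter_nonzero[OF m(1)]
      by (auto simp: upward_def j_def[symmetric] sgn_if split: if_splits)
    ultimately show ?thesis using that[of "nx l"] nl(1) lt by (auto simp: positions_def)
  qed
  have "p \<notin> positions i j" if "p \<in> {l<..<m}" for p
    using nk(5)[of p] nl(5)[of p] that m(3,4) kl(3) pos_in_I[of p]
    by (auto simp: positions_def i_def j_def)
  then have "{l<..<m} \<inter> positions i j = {}" by blast
  moreover have lP: "l \<in> positions i j" using l by (simp add: positions_def j_def)
  ultimately have "l \<in> cuts i j" using m unfolding cuts_def by auto
  moreover have "l \<noteq> Max (positions i j)" using Max_ge[OF finite_positions m(1)] m(2) by auto
  moreover have "a = cut_arrow i j l"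
    using a top l calculation(2) letter_nonzero[OF l] by (auto simp: cut_arrow_def upward_def j_def)
  ultimately show "a \<in> ?R" using ij l by fastforce
next
  fix a assume "a \<in> ?R"
  then obtain i j s where ij: "{i, j} \<in> E" and s: "s \<in> cuts i j" "s \<noteq> 0" "s \<noteq> Max (positions i j)"
    and a: "a = cut_arrow i j s" by blast
  have "cut_arrow i j s \<in> inclined_arrows r A w"
    if ij: "{i, j} \<in> E" and s: "s \<in> cuts i j" "s \<noteq> 0" "s \<noteq> Max (positions i j)"
      and j: "st s = j" for i j
  proof -
    have sP: "s \<in> positions i j" using cuts_cases s by blast
    then have s1: "s \<in> {1..N}" by (auto simp: positions_def)
    obtain m where m: "m \<in> positions i j" "s < m" "{s<..<m} \<inter> positions i j = {}"
      "upward j s \<noteq> upward j m"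
      using s by (auto simp: cuts_def split: if_splits)
    have r: "i \<in> {1..r}" "j \<in> {1..r}" "i \<noteq> j" "A i j < 0" using ij edge_iff by auto
    define k where "k = latest i s"
    have k: "k \<in> I" "st k = i" "k < s"
      using latest[of i s] r s1 j by (auto simp: k_def order_less_le)
    have m1: "m \<in> {1..N}" "st m \<in> {i, j}" using m by (auto simp: positions_def)
    note nk = next_index[OF k(1)] and ns = next_index[OF pos_in_I[OF s1]]
    have later: "m \<le> n" if "s < n" "n \<in> {1..N}" "st n \<in> {i, j}" for n
      using m(3) that by (force simp: positions_def)
    have nk_s: "s < nx k"
    proof (rule ccontr)
      assume "\<not> s < nx k"
      then have "nx k \<le> k"
        unfolding k_def using nk k s1 by (intro latest_greatest) (auto simp: k_def intro: pos_in_I)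
      then show False using nk(1) by simp
    qed
    have nk_m: "m \<le> nx k" using later[of "nx k"] nk nk_s m1 k by (cases "nx k \<le> N") auto
    have ns_m: "m \<le> nx s" using later[of "nx s"] ns m1 j by (cases "nx s \<le> N") auto
    have arrow: "cut_arrow i j s = (if letter w s < 0 then Inclined k s else Inclined s k)"
      using s latest_self[OF s1] j letter_nonzero[OF s1] by (auto simp: cut_arrow_def upward_def k_def)
    have cond: "s < nx k \<and> nx k < nx s \<and> sgn (letter w s) = sgn (letter w (nx k)) \<or>
       s < nx s \<and> nx s < nx k \<and> sgn (letter w s) = - sgn (letter w (nx s))"
    proof (cases "st m = i")
      case True
      then have eq: "nx k = m" using nk(5)[of m] nk_m pos_in_I[OF m1(1)] k m by auto
      moreover have "nx s \<noteq> m" using ns(4) m1 j r True by auto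
      moreover have "sgn (letter w s) = sgn (letter w m)"
        using m(4) True j r letter_nonzero[OF s1] letter_nonzero[OF m1(1)]
        by (auto simp: upward_def sgn_if)
      ultimately show ?thesis using nk_s ns_m by auto
    next
      case False
      then have mj: "st m = j" using m1 by auto
      then have eq: "nx s = m" using ns(5)[of m] ns_m pos_in_I[OF m1(1)] j m by auto
      moreover have "nx k \<noteq> m" using nk(4) m1 k r mj by auto
      moreover have "sgn (letter w s) = - sgn (letter w m)"
        using m(4) mj j letter_nonzero[OF s1] letter_nonzero[OF m1(1)]
        by (auto simp: upward_def sgn_if)
      ultimately show ?thesis using ns(1) nk_m by auto
    qed
    show ?thesis
      unfolding inclined_arrows_def mem_Collect_eq
      by (rule exI[of _ k], rule exI[of _ s])
        (use arrow cond k s1 pos_in_I[OF s1] r j in auto)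
  qed
  note * = this
  have sP: "s \<in> positions i j" using cuts_cases s by blast
  have ne: "i \<noteq> j" using ij edge_iff by blast
  show "a \<in> inclined_arrows r A w"
  proof (cases "st s = j")
    case True
    then show ?thesis using * ij s a by blast
  next
    case False
    then have i: "st s = i" using sP by (auto simp: positions_def)
    have "cut_arrow j i s \<in> inclined_arrows r A w"
      using *[of j i] ij s i cuts_commute[OF ne]
      by (simp add: insert_commute positions_commute[of j i])
    then show ?thesis using cut_arrow_commute[OF ne s(1)] a by simp
  qed
qed

abbreviation "Q \<equiv> bfz_quiver r A w"

lemma arcs_eq: "arcs Q = vertical_arrow ` {1..N} \<union> {cut_arrow i j s | i j s. {i, j} \<in> E \<and> s \<in> cuts i j}"
  (is "_ = _ \<union> ?C")
proof -
  have "inclined_arrows r A w \<union> bottom_arrows r A w \<union> top_arrows r A w = ?C"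
  proof (intro equalityI subsetI)
    fix a assume "a \<in> inclined_arrows r A w \<union> bottom_arrows r A w \<union> top_arrows r A w"
    then show "a \<in> ?C"
      unfolding inclined_arrows_eq bottom_arrows_eq top_arrows_eq using extreme_cuts by blast
  next
    fix a assume "a \<in> ?C"
    then obtain i j s where ijs: "{i, j} \<in> E" "s \<in> cuts i j" "a = cut_arrow i j s" by blast
    moreover from this have "positions i j \<noteq> {}" by (auto simp: cuts_def)
    ultimately show "a \<in> inclined_arrows r A w \<union> bottom_arrows r A w \<union> top_arrows r A w"
      unfolding inclined_arrows_eq bottom_arrows_eq top_arrows_eq by blast
  qed
  moreover have "arcs Q = vertical_arrows r w \<union>
      (inclined_arrows r A w \<union> bottom_arrows r A w \<union> top_arrows r A w)"
    by (simp add: bfz_quiver_def Un_assoc)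
  ultimately show ?thesis by (simp only: vertical_arrows_eq)
qed

subsection \<open>Blocks between consecutive cuts\<close>

text \<open>
  Two consecutive cuts of a strip; the letters between them will bound a face.
\<close>

definition block :: "nat \<Rightarrow> nat \<Rightarrow> int \<Rightarrow> int \<Rightarrow> bool" where
  "block i j s s' \<longleftrightarrow> {i, j} \<in> E \<and> s \<in> cuts i j \<and> s' \<in> cuts i j \<and> s < s' \<and>
     {s<..<s'} \<inter> cuts i j = {}"

lemma block_commute: "block i j s s' \<Longrightarrow> block j i s s'"
  using cuts_commute[of i j] edge_iff by (auto simp: block_def insert_commute)

lemma block_end: "block i j s s' \<Longrightarrow> s' \<in> positions i j"
  using cuts_cases[of s' i j] cuts_nonneg[of s i j] by (auto simp: block_def)

text \<open>
  The letters of a block all have the same direction: the last one that differed from the end of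
  the block would be followed by a letter of the other direction, hence would be a cut.
\<close>

lemma block_upward:
  assumes "block i j s s'" "l \<in> positions i j" "s < l" "l \<le> s'"
  shows "upward j l = upward j s'"
proof (rule ccontr)
  assume contra: "upward j l \<noteq> upward j s'"
  \<comment> \<open>L is the last letter of the block that differs from its end, m its successor in the strip\<close>
  define D where "D = {k \<in> positions i j. s < k \<and> k \<le> s' \<and> upward j k \<noteq> upward j s'}"
  have fin: "finite D" "D \<noteq> {}" using finite_positions assms contra by (auto simp: D_def)
  define L where "L = Max D"
  have L: "L \<in> positions i j" "s < L" "L \<le> s'" "upward j L \<noteq> upward j s'"
    using Max_in[OF fin] by (auto simp: L_def D_def)
  then have "L < s'" by (auto simp: order_less_le)
  define R where "R = {k \<in> positions i j. L < k}"
  have R: "finite R" "s' \<in> R"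
    using finite_positions block_end[OF assms(1)] \<open>L < s'\<close> by (auto simp: R_def)
  define m where "m = Min R"
  have "m \<in> R" using Min_in[of R] R unfolding m_def by blast
  moreover have "m \<le> k" if "k \<in> R" for k using Min_le[OF R(1) that] by (simp add: m_def)
  ultimately have m: "m \<in> positions i j" "L < m" "m \<le> s'" "{L<..<m} \<inter> positions i j = {}"
    using R by (fastforce simp: R_def)+
  have "upward j m = upward j s'"
  proof (rule ccontr)
    assume "upward j m \<noteq> upward j s'"
    then have "m \<in> D" using m L by (auto simp: D_def)
    then show False using Max_ge[OF fin(1), of m] m(2) by (simp add: L_def)
  qed
  then have "L \<in> cuts i j" using L m by (auto simp: cuts_def)
  then show False using assms(1) L \<open>L < s'\<close> by (auto simp: block_def)
qed

text \<open>
  If the letters of a block are upward with respect to j, its lower arrow leads from i to j and its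
  upper arrow from j to i. The lower one does because it follows a letter of the previous block, which
  is directed the other way, or because it is the bottom arrow.
\<close>

lemma block_cut_arrow_ends:
  assumes b: "block i j s s'" and up: "upward j s'"
  shows "arrow_tail (cut_arrow i j s) = latest i s" "arrow_head (cut_arrow i j s) = latest j s"
    and "arrow_tail (cut_arrow i j s') = latest j s'" "arrow_head (cut_arrow i j s') = latest i s'"
proof -
  have s'P: "s' \<in> positions i j" by (rule block_end[OF b])
  have "s' > 0" using s'P by (auto simp: positions_def)
  then show "arrow_tail (cut_arrow i j s') = latest j s'" "arrow_head (cut_arrow i j s') = latest i s'"
    using up by (auto simp: cut_arrow_def)
  have ss': "s < s'" "s \<in> cuts i j" using b by (auto simp: block_def)
  have "(if s = 0 then upward j (Min (positions i j)) else s \<noteq> Max (positions i j) \<and> \<not> upward j s)"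
  proof (cases "s = 0")
    case True
    have "Min (positions i j) \<in> positions i j" using Min_in[OF finite_positions] s'P by blast
    moreover from this have "0 < Min (positions i j)" by (auto simp: positions_def)
    moreover have "Min (positions i j) \<le> s'" using Min_le[OF finite_positions s'P] .
    ultimately show ?thesis using block_upward[OF b] up True by simp
  next
    case False
    have nM: "s \<noteq> Max (positions i j)" using Max_ge[OF finite_positions s'P] ss' by auto
    then obtain m where m: "m \<in> positions i j" "s < m" "{s<..<m} \<inter> positions i j = {}"
      "upward j s \<noteq> upward j m"
      using ss' False by (auto simp: cuts_def split: if_splits)
    have "m \<le> s'" using m(3) s'P ss' by force
    then have "upward j m" using block_upward[OF b m(1,2)] up by simp
    then show ?thesis using m nM False by simp
  qed
  then show "arrow_tail (cut_arrow i j s) = latest i s" "arrow_head (cut_arrow i j s) = latest j s"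
    by (auto simp: cut_arrow_def split: if_splits)
qed

subsection \<open>The drawing\<close>

lemma realization_cases:
  assumes "x \<in> realization {1..r} E"
  obtains (string) k where "k \<in> {1..r}" "x = indicator {k}"
  | (strip) i j where "{i, j} \<in> E" "x \<in> cell {i, j}" "0 < x i" "0 < x j"
proof -
  from assms consider k where "k \<in> {1..r}" "x \<in> cell {k}" | e where "e \<in> E" "x \<in> cell e"
    by (auto simp: realization_def)
  then show ?thesis
  proof cases
    case 1
    then show ?thesis using string by (simp add: cell_singleton)
  next
    case 2
    then obtain i j where e: "e = {i, j}" "i \<in> {1..r}" "j \<in> {1..r}" "i \<noteq> j" using edge_cases by blast
    then consider "x i = 0" | "x j = 0" | "0 < x i" "0 < x j"
      using 2 by (force simp: cell_pair_iff)
    then show ?thesis using string strip e 2 cell_pair_ends[OF e(4)] by cases blast+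
  qed
qed

abbreviation "img a \<equiv> path_image (bfz_curve r w a)"

abbreviation "level i j s \<equiv> tilt i j (ht (latest i s)) (ht (latest j s))"

lemma img_vertical_arrow:
  assumes "l \<in> {1..N}"
  shows "img (vertical_arrow l) = {indicator {st l}} \<times> {ht (prv l)..ht l}"
proof -
  have "ht (prv l) \<le> ht l" using prv[OF assms] height_less pos_in_I[OF assms] by fastforce
  then show ?thesis
    unfolding bfz_curve_def
    by (simp add: vertical_arrow_def prv[OF assms] path_image_straight_vertical closed_segment_eq_real_ivl)
qed

lemma img_cut_arrow:
  assumes "{i, j} \<in> E" "s \<in> cuts i j"
  shows "img (cut_arrow i j s) = slanted_segment i j (ht (latest i s)) (ht (latest j s))"
proof -
  have r: "i \<in> {1..r}" "j \<in> {1..r}" "i \<noteq> j" and s: "0 \<le> s"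
    using assms edge_iff cuts_nonneg by auto
  have "arrow_tail (cut_arrow i j s) = latest i s \<and> arrow_head (cut_arrow i j s) = latest j s \<or>
      arrow_tail (cut_arrow i j s) = latest j s \<and> arrow_head (cut_arrow i j s) = latest i s"
    using cut_arrow_ends[of i j s] by (auto simp: doubleton_eq_iff)
  then show ?thesis
    unfolding bfz_curve_def
    using r path_image_straight_slanted slanted_segment_commute by (auto simp: latest[OF _ s])
qed

lemma arcs_cases:
  assumes "a \<in> arcs Q"
  obtains (vertical) l where "l \<in> {1..N}" "a = vertical_arrow l"
  | (slanted) i j s where "{i, j} \<in> E" "s \<in> cuts i j" "a = cut_arrow i j s"
  using assms unfolding arcs_eq by blast

lemma vertical_arrow_in_arcs: "l \<in> {1..N} \<Longrightarrow> vertical_arrow l \<in> arcs Q"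
  unfolding arcs_eq by blast

lemma cut_arrow_in_arcs: "{i, j} \<in> E \<Longrightarrow> s \<in> cuts i j \<Longrightarrow> cut_arrow i j s \<in> arcs Q"
  unfolding arcs_eq by blast

lemma cut_arrow_edge_cong:
  assumes "{i, j} \<in> E" "{i', j'} = {i, j}" "s \<in> cuts i' j'"
  shows "s \<in> cuts i j" "cut_arrow i' j' s = cut_arrow i j s"
  using assms cuts_commute cut_arrow_commute edge_iff by (fastforce simp: doubleton_eq_iff)+

lemma arrow_in_open_strip:
  assumes "a \<in> arcs Q" "(x, t) \<in> img a" "{i, j} \<in> E" "x \<in> cell {i, j}" "0 < x i" "0 < x j"
  obtains s where "s \<in> cuts i j" "a = cut_arrow i j s" "t = level i j s x"
  using assms(1)
proof (cases rule: arcs_cases)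
  case (vertical l)
  then have x: "x = indicator {st l}" using assms(2) img_vertical_arrow by auto
  have "i \<noteq> j" using assms(3) edge_iff by blast
  then show ?thesis using assms(5,6) unfolding x by (auto simp: indicator_def split: if_splits)
next
  case (slanted i' j' s)
  have x: "x \<in> cell {i', j'}" using assms(2) slanted img_cut_arrow by (auto simp: slanted_segment_def)
  have ij: "i \<noteq> j" using assms(3) edge_iff by blast
  have eq: "{i', j'} = {i, j}"
    using cell_meeting_open_edge[OF ij edge_card[OF slanted(1)] assms(4) x assms(5,6)] .
  note s = cut_arrow_edge_cong[OF assms(3) eq slanted(2)]
  have "t = level i j s x"
    using assms(2) img_cut_arrow[OF assms(3) s(1)] unfolding slanted(3) s(2)
    by (auto simp: slanted_segment_def)
  then show ?thesis using that s slanted(3) by simp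
qed

lemma arrow_on_string:
  assumes "a \<in> arcs Q" "(indicator {k}, t) \<in> img a"
  obtains (vertical) l where "l \<in> {1..N}" "a = vertical_arrow l" "st l = k" "ht (prv l) \<le> t" "t \<le> ht l"
  | (slanted) j s where "{k, j} \<in> E" "s \<in> cuts k j" "a = cut_arrow k j s" "t = ht (latest k s)"
  using assms(1)
proof (cases rule: arcs_cases)
  case (vertical l)
  have "(indicator {k} :: nat \<Rightarrow> real) = indicator {st l}" using assms(2) vertical img_vertical_arrow by auto
  then have "k = st l" by (metis indicator_eq_1_iff singletonD singletonI)
  then show ?thesis using that(1) assms(2) vertical img_vertical_arrow by auto
next
  case (slanted i j s)
  have x: "indicator {k} \<in> cell {i, j}" "t = level i j s (indicator {k})"
    using assms(2) slanted img_cut_arrow by (auto simp: slanted_segment_def)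
  have ij: "i \<noteq> j" using slanted(1) edge_iff by blast
  then consider "k = i" | "k = j" using x indicator_in_cell_pair by blast
  then show ?thesis
  proof cases
    case 1
    then show ?thesis using that(2)[of j s] slanted x ij by simp
  next
    case 2
    have e: "{j, i} \<in> E" using slanted(1) by (simp add: insert_commute)
    have "s \<in> cuts j i" "cut_arrow i j s = cut_arrow j i s"
      using cut_arrow_edge_cong[OF e insert_commute slanted(2)] .
    then show ?thesis using that(2)[of i s] e slanted(3) x(2) ij 2 by simp
  qed
qed

text \<open>
  Both ends of the cut segments move up with the cut, so the segments of a strip are ordered by
  height.
\<close>

lemma level_mono:
  assumes "{i, j} \<in> E" "0 \<le> s" "s \<le> s'" "x \<in> cell {i, j}"
  shows "level i j s x \<le> level i j s' x"
proof -
  have "i \<in> {1..r}" "j \<in> {1..r}" "i \<noteq> j" using assms edge_iff by auto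
  then show ?thesis using assms
    by (intro tilt_mono) (auto simp: height_le_iff latest latest_mono cell_pair_iff)
qed

lemma level_nonneg:
  assumes "{i, j} \<in> E" "0 \<le> s" "x \<in> cell {i, j}"
  shows "0 \<le> level i j s x"
proof -
  have r: "i \<in> {1..r}" "j \<in> {1..r}" "i \<noteq> j" using assms edge_iff by auto
  then have "0 \<le> ht (latest i s)" "0 \<le> ht (latest j s)"
    using height_pos latest(1) assms(2) by (simp_all add: less_imp_le)
  then show ?thesis using assms(3) r(3) by (auto simp: tilt_def cell_pair_iff)
qed

lemma cuts_slab:
  assumes "{i, j} \<in> E" "s \<in> cuts i j" "s' \<in> cuts i j" "s < s'"
  shows "slab i j (ht (latest i s)) (ht (latest j s)) (ht (latest i s')) (ht (latest j s'))"
proof -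
  have r: "i \<in> {1..r}" "j \<in> {1..r}" "i \<noteq> j" using assms edge_iff by auto
  have s: "0 \<le> s" "0 \<le> s'" using assms cuts_nonneg by auto
  have "latest i s \<le> latest i s'" "latest j s \<le> latest j s'"
    using r s assms(4) by (auto intro!: latest_mono)
  moreover from this have "latest i s < latest i s' \<or> latest j s < latest j s'"
    using latest_cuts_inj[OF r(1,2) assms(2,3)] assms(4) by linarith
  ultimately show ?thesis
    using r s by unfold_locales (auto simp: height_le_iff height_less_iff latest)
qed

lemma level_less:
  assumes "{i, j} \<in> E" "s \<in> cuts i j" "s' \<in> cuts i j" "s < s'" "0 < x i" "0 < x j"
  shows "level i j s x < level i j s' x"
proof -
  interpret slab i j "ht (latest i s)" "ht (latest j s)" "ht (latest i s')" "ht (latest j s')"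
    by (rule cuts_slab[OF assms(1-4)])
  show ?thesis using aa' bb' nontrivial assms(5,6) by (rule tilt_strict_mono)
qed

lemma level_less_iff:
  assumes "{i, j} \<in> E" "s \<in> cuts i j" "s' \<in> cuts i j" "0 < x i" "0 < x j"
  shows "level i j s x < level i j s' x \<longleftrightarrow> s < s'"
  using level_less[OF assms(1-3), of x] level_less[OF assms(1,3,2), of x] assms(4,5)
  by (metis less_asym less_irrefl linorder_neqE_linordered_idom)

text \<open>
  Over an open edge distinct cut segments lie strictly above each other. On a string a slanted
  arrow has a vertex, and two vertical arrows that touch do so in their common end.
\<close>

lemma arrows_meet_at_vertex:
  assumes "a \<in> arcs Q" "b \<in> arcs Q" "a \<noteq> b" "(x, t) \<in> img a" "(x, t) \<in> img b"
    and "x \<in> realization {1..r} E"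
  obtains v where "v \<in> I" "(x, t) = string_point (st v) (ht v)"
  using assms(6)
proof (cases rule: realization_cases)
  case (strip i j)
  obtain s where s: "s \<in> cuts i j" "a = cut_arrow i j s" "t = level i j s x"
    using arrow_in_open_strip[OF assms(1,4) strip] .
  obtain s' where s': "s' \<in> cuts i j" "b = cut_arrow i j s'" "t = level i j s' x"
    using arrow_in_open_strip[OF assms(2,5) strip] .
  have "s \<noteq> s'" using s s' assms(3) by auto
  then show ?thesis
    using level_less[OF strip(1) s(1) s'(1), of x] level_less[OF strip(1) s'(1) s(1), of x]
      strip(3,4) s(3) s'(3) by linarith
next
  case (string k)
  have vertex: ?thesis if "v \<in> I" "st v = k" "t = ht v" for v
    using that(1) string that by (intro \<open>\<And>v. v \<in> I \<Longrightarrow> _ \<Longrightarrow> thesis\<close>[of v]) (simp_all add: string_point_def)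
  have cut: ?thesis if "{k, j} \<in> E" "s \<in> cuts k j" "t = ht (latest k s)" for j s
    using vertex[of "latest k s"] that latest[of k s] string cuts_nonneg by blast
  have va: "(indicator {k}, t) \<in> img a" "(indicator {k}, t) \<in> img b" using assms string by auto
  have vert: ?thesis if l: "l \<in> {1..N}" "st l = k" "t \<le> ht l"
    and m: "m \<in> {1..N}" "st m = k" "ht (prv m) \<le> t" and "l < m" for l m
  proof -
    have "l \<le> prv m" using l m \<open>l < m\<close> by (intro latest_greatest) (auto simp: pos_in_I)
    then have "ht l \<le> ht (prv m)" using height_le_iff pos_in_I[OF l(1)] prv(1)[OF m(1)] by blast
    then show ?thesis using vertex[of l] l m pos_in_I by auto
  qed
  from assms(1) va(1) show ?thesis
  proof (cases rule: arrow_on_string)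
    case l: (vertical l)
    from assms(2) va(2) show ?thesis
    proof (cases rule: arrow_on_string)
      case m: (vertical m)
      then have "l \<noteq> m" using l assms(3) by auto
      then show ?thesis using vert[of l m] vert[of m l] l m by linarith
    next
      case (slanted j s)
      then show ?thesis by (intro cut)
    qed
  next
    case (slanted j s)
    then show ?thesis by (intro cut)
  qed
qed

lemma arc_ends:
  assumes "a \<in> arcs Q"
  shows "arrow_tail a \<in> I" "arrow_head a \<in> I" "arrow_tail a \<noteq> arrow_head a"
proof -
  have "arrow_tail a \<in> I \<and> arrow_head a \<in> I \<and> arrow_tail a \<noteq> arrow_head a"
    using assms
  proof (cases rule: arcs_cases)
    case (vertical l)
    then show ?thesis using prv[of l] pos_in_I[of l] by (auto simp: vertical_arrow_def)
  next
    case (slanted i j s)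
    have r: "i \<in> {1..r}" "j \<in> {1..r}" "i \<noteq> j" and s: "0 \<le> s"
      using slanted edge_iff cuts_nonneg by auto
    have "latest i s \<noteq> latest j s" using latest(3)[OF r(1) s] latest(3)[OF r(2) s] r(3) by auto
    then show ?thesis using cut_arrow_ends[of i j s] latest(1)[OF r(1) s] latest(1)[OF r(2) s] slanted(3)
      by (auto simp: doubleton_eq_iff)
  qed
  then show "arrow_tail a \<in> I" "arrow_head a \<in> I" "arrow_tail a \<noteq> arrow_head a" by auto
qed

lemma finite_arcs_Q: "finite (arcs Q)"
proof (rule finite_subset)
  show "arcs Q \<subseteq> vertical_arrow ` {1..N} \<union> (\<Union>i\<in>{1..r}. \<Union>j\<in>{1..r}. cut_arrow i j ` cuts i j)"
    unfolding arcs_eq using edge_iff by fastforce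
qed (auto simp: finite_cuts)

lemma arrow_in_cylinder:
  assumes "a \<in> arcs Q"
  shows "img a \<subseteq> cylinder {1..r} E"
  using assms
proof (cases rule: arcs_cases)
  case (vertical l)
  have "0 \<le> ht (prv l)" using height_pos prv(1)[OF vertical(1)] by (simp add: less_imp_le)
  then show ?thesis
    using img_vertical_arrow[OF vertical(1)] vertical st_in[OF pos_in_I[OF vertical(1)]]
    by (auto simp: cylinder_def realization_def cell_singleton)
next
  case (slanted i j s)
  then show ?thesis
    using img_cut_arrow[OF slanted(1,2)] level_nonneg[OF slanted(1) cuts_nonneg[OF slanted(2)]]
    by (auto simp: cylinder_def realization_def slanted_segment_def)
qed

lemma arrow_avoids_vertices:
  assumes "a \<in> arcs Q" "v \<in> I" "string_point (st v) (ht v) \<in> img a"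
  shows "v = arrow_tail a \<or> v = arrow_head a"
proof -
  have "(indicator {st v}, ht v) \<in> img a" using assms(3) by (simp add: string_point_def)
  with assms(1) show ?thesis
  proof (cases rule: arrow_on_string)
    case (vertical l)
    then have "prv l \<le> v" "v \<le> l"
      using height_le_iff prv(1) pos_in_I assms(2) by blast+
    moreover have "v \<le> prv l" if "v < l"
      using latest_greatest[of v "l - 1" "st l"] that vertical assms(2) by auto
    ultimately have "v = prv l \<or> v = l" by linarith
    then show ?thesis using vertical(2) by (auto simp: vertical_arrow_def)
  next
    case (slanted j s)
    have "st v \<in> {1..r}" "0 \<le> s" using slanted edge_iff cuts_nonneg by auto
    then have "v = latest (st v) s" using height_eq_iff assms(2) latest(1) slanted(4) by blast
    then show ?thesis using cut_arrow_ends[of "st v" j s] slanted(3) by auto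
  qed
qed

lemma curve_ends:
  "pathstart (bfz_curve r w a) = string_point (st (arrow_tail a)) (ht (arrow_tail a))"
  "pathfinish (bfz_curve r w a) = string_point (st (arrow_head a)) (ht (arrow_head a))"
  by (simp_all add: bfz_curve_def straight_segment_ends)

lemma arrows_noncrossing:
  assumes "a \<in> arcs Q" "b \<in> arcs Q" "a \<noteq> b"
  shows "img a \<inter> img b \<subseteq>
    {pathstart (bfz_curve r w a), pathfinish (bfz_curve r w a)} \<inter>
    {pathstart (bfz_curve r w b), pathfinish (bfz_curve r w b)}"
proof
  fix p assume p: "p \<in> img a \<inter> img b"
  obtain x t where xt: "p = (x, t)" by force
  have "x \<in> realization {1..r} E"
    using arrow_in_cylinder[OF assms(1)] p xt by (auto simp: cylinder_def)
  then obtain v where v: "v \<in> I" "p = string_point (st v) (ht v)"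
    using arrows_meet_at_vertex[OF assms, of x t] p xt by auto
  then have "v = arrow_tail a \<or> v = arrow_head a" "v = arrow_tail b \<or> v = arrow_head b"
    using p arrow_avoids_vertices assms by auto
  then show "p \<in> {pathstart (bfz_curve r w a), pathfinish (bfz_curve r w a)} \<inter>
    {pathstart (bfz_curve r w b), pathfinish (bfz_curve r w b)}"
    using v(2) by (auto simp: curve_ends)
qed

sublocale quiver_on_cylinder Q "{1..r}" E "bfz_frozen r w" st ht "bfz_curve r w"
proof
  show "e \<in> E \<Longrightarrow> e \<subseteq> {1..r} \<and> card e = 2" for e
    using edge_cases[of e] by auto
  show "inj_on (\<lambda>v. (st v, ht v)) (verts Q)"
    using height_eq_iff by (auto simp: bfz_quiver_def inj_on_def)
  show "simple_path (bfz_curve r w a)" if "a \<in> arcs Q" for a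
    unfolding bfz_curve_def
    using arc_ends[OF that] height_eq_iff by (intro simple_path_straight_segment) auto
  show "v = tail Q a \<or> v = head Q a"
    if "a \<in> arcs Q" "v \<in> verts Q" "string_point (st v) (ht v) \<in> img a" for a v
    using arrow_avoids_vertices[of a v] that by (simp add: bfz_quiver_def)
qed (use arc_ends finite_I finite_arcs_Q st_in height_pos arrow_in_cylinder curve_ends
    arrows_noncrossing in \<open>auto simp: bfz_quiver_def bfz_frozen_def less_imp_le\<close>)


subsection \<open>Faces\<close>

abbreviation "complement \<equiv> cylinder {1..r} E - (\<Union>a\<in>arcs Q. img a)"

abbreviation "block_face i j s s' \<equiv>
  slab.open_slab i j (ht (latest i s)) (ht (latest j s)) (ht (latest i s')) (ht (latest j s'))"

abbreviation "closed_block_face i j s s' \<equiv>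
  slab.closed_slab i j (ht (latest i s)) (ht (latest j s)) (ht (latest i s')) (ht (latest j s'))"

text \<open>
  The boundary of the face that belongs to a block.
\<close>

definition block_arrows :: "nat \<Rightarrow> nat \<Rightarrow> int \<Rightarrow> int \<Rightarrow> bfz_arrow set" where
  "block_arrows i j s s' = {cut_arrow i j s, cut_arrow i j s'} \<union>
     vertical_arrow ` {l \<in> positions i j. s < l \<and> l \<le> s'}"

lemma blockD:
  assumes "block i j s s'"
  shows "{i, j} \<in> E" "s \<in> cuts i j" "s' \<in> cuts i j" "s < s'" "0 \<le> s" "0 \<le> s'"
    "i \<in> {1..r}" "j \<in> {1..r}" "i \<noteq> j"
    "slab i j (ht (latest i s)) (ht (latest j s)) (ht (latest i s')) (ht (latest j s'))"
    "\<And>c. c \<in> cuts i j \<Longrightarrow> c \<le> s \<or> s' \<le> c"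
proof -
  show b: "{i, j} \<in> E" "s \<in> cuts i j" "s' \<in> cuts i j" "s < s'"
    using assms by (auto simp: block_def)
  then show "i \<in> {1..r}" "j \<in> {1..r}" "i \<noteq> j" using edge_iff by auto
  show "0 \<le> s" "0 \<le> s'" using b cuts_nonneg by auto
  show "slab i j (ht (latest i s)) (ht (latest j s)) (ht (latest i s')) (ht (latest j s'))"
    by (rule cuts_slab[OF b])
  show "c \<le> s \<or> s' \<le> c" if "c \<in> cuts i j" for c
  proof -
    have "c \<notin> {s<..<s'}" using assms that by (auto simp: block_def)
    then show ?thesis by auto
  qed
qed

lemma in_block_face:
  assumes "block i j s s'"
  shows "(x, t) \<in> block_face i j s s' \<longleftrightarrow>
    x \<in> cell {i, j} \<and> 0 < x i \<and> 0 < x j \<and> level i j s x < t \<and> t < level i j s' x"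
  using slab.open_slab_def[OF blockD(10)[OF assms]] by simp

lemma in_closed_block_face:
  assumes "block i j s s'"
  shows "(x, t) \<in> closed_block_face i j s s' \<longleftrightarrow> x \<in> cell {i, j} \<and> level i j s x \<le> t \<and> t \<le> level i j s' x"
  using slab.closed_slab_def[OF blockD(10)[OF assms]] by simp

lemma block_face_commute: "block i j s s' \<Longrightarrow> block_face j i s s' = block_face i j s s'"
  using in_block_face[of i j s s'] in_block_face[of j i s s'] block_commute[of i j s s']
  by (auto simp: insert_commute tilt_commute[of j i])

lemma block_arrows_commute:
  assumes "block i j s s'"
  shows "block_arrows j i s s' = block_arrows i j s s'"
  using blockD[OF assms] by (simp add: block_arrows_def cut_arrow_commute positions_commute[of j i])

lemma block_arrows_subset_arcs: "block i j s s' \<Longrightarrow> block_arrows i j s s' \<subseteq> arcs Q"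
  using blockD[of i j s s'] cut_arrow_in_arcs vertical_arrow_in_arcs
  by (auto simp: block_arrows_def positions_def)

lemma block_face_subset_complement:
  assumes "block i j s s'"
  shows "block_face i j s s' \<subseteq> complement"
proof
  fix p assume p: "p \<in> block_face i j s s'"
  obtain x t where xt: "p = (x, t)" by force
  note b = blockD[OF assms]
  have x: "x \<in> cell {i, j}" "0 < x i" "0 < x j" and t: "level i j s x < t" "t < level i j s' x"
    using p xt in_block_face[OF assms] by auto
  have "(x, t) \<notin> img a" if a: "a \<in> arcs Q" for a
  proof
    assume "(x, t) \<in> img a"
    then obtain c where c: "c \<in> cuts i j" "t = level i j c x"
      using arrow_in_open_strip[OF a _ b(1) x] by blast
    then have "s < c \<and> c < s'"
      using t level_less_iff[OF b(1)] b(2,3) x(2,3) by auto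
    then show False using b(11)[OF c(1)] by auto
  qed
  moreover have "(x, t) \<in> cylinder {1..r} E"
    using x b(1) level_nonneg[OF b(1,5) x(1)] t by (auto simp: cylinder_def realization_def)
  ultimately show "p \<in> complement" using xt by auto
qed

text \<open>
  The vertical arrows of a string fill it without gaps. The lowest vertex at or above the given
  height is the upper end of the arrow needed.
\<close>

lemma string_covered:
  assumes "k \<in> {1..r}" "0 \<le> s" "s \<le> s'" "ht (latest k s) \<le> t" "t \<le> ht (latest k s')"
  shows "t = ht (latest k s) \<or>
    (\<exists>l\<in>{1..N}. st l = k \<and> s < l \<and> l \<le> s' \<and> ht (prv l) \<le> t \<and> t \<le> ht l)"
proof (cases "t = ht (latest k s)")
  case False
  \<comment> \<open>the vertices of the string at or above height t\<close>
  define S where "S = {l \<in> I. st l = k \<and> t \<le> ht l}"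
  note k = latest[OF assms(1,2)] and k' = latest[OF assms(1) order.trans[OF assms(2,3)]]
  have fin: "finite S" "latest k s' \<in> S" using finite_I k' assms by (auto simp: S_def)
  define l where "l = Min S"
  have l: "l \<in> I" "st l = k" "t \<le> ht l" "l \<le> latest k s'"
    using Min_in[OF fin(1)] Min_le[OF fin] fin(2) by (auto simp: l_def S_def)
  then have "latest k s < l" using False assms(4) k height_less_iff[OF k(1) l(1)] by linarith
  then have "s < l" using latest_greatest[OF l(1) _ l(2), of s] by (meson leD leI)
  then have l1: "l \<in> {1..N}" using I_cases[OF l(1)] assms(2) by auto
  have "prv l \<notin> S" using Min_le[OF fin(1), of "prv l"] prv(2)[OF l1] by (auto simp: l_def)
  then have "ht (prv l) \<le> t" using prv[OF l1] l(2) by (auto simp: S_def)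
  then show ?thesis using l1 l \<open>s < l\<close> k'(2) by force
qed simp

lemma slanted_in_block_boundary:
  assumes "block i j s s'" "c = s \<or> c = s'"
  shows "img (cut_arrow i j c) \<subseteq> closed_block_face i j s s' - block_face i j s s'"
proof
  note b = blockD[OF assms(1)]
  fix p assume p: "p \<in> img (cut_arrow i j c)"
  obtain x t where xt: "p = (x, t)" by force
  have "c \<in> cuts i j" using assms(2) b by auto
  then have x: "x \<in> cell {i, j}" "t = level i j c x"
    using p xt img_cut_arrow[OF b(1)] by (auto simp: slanted_segment_def)
  have "level i j s x \<le> level i j s' x" using level_mono[OF b(1,5) _ x(1)] b(4) by auto
  then show "p \<in> closed_block_face i j s s' - block_face i j s s'"
    using x xt assms(2) in_block_face[OF assms(1)] in_closed_block_face[OF assms(1)] by auto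
qed

lemma vertical_in_block_boundary:
  assumes "block i j s s'" "l \<in> positions i j" "s < l" "l \<le> s'"
  shows "img (vertical_arrow l) \<subseteq> closed_block_face i j s s' - block_face i j s s'"
proof
  note b = blockD[OF assms(1)]
  fix p assume p: "p \<in> img (vertical_arrow l)"
  have l: "l \<in> {1..N}" "st l \<in> {i, j}" "st l \<in> {1..r}"
    using assms(2) b by (auto simp: positions_def)
  obtain t where t: "p = (indicator {st l}, t)" "ht (prv l) \<le> t" "t \<le> ht l"
    using p img_vertical_arrow[OF l(1)] by auto
  have "latest (st l) s \<le> prv l" using prv_le_latest[OF l(1) b(5) assms(3)] .
  then have 1: "ht (latest (st l) s) \<le> t"
    using t height_le_iff latest(1)[OF l(3) b(5)] prv(1)[OF l(1)] by force
  have "l \<le> latest (st l) s'" using latest_greatest[OF pos_in_I[OF l(1)] assms(4)] by simp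
  then have 2: "t \<le> ht (latest (st l) s')"
    using t height_le_iff latest(1)[OF l(3) b(6)] pos_in_I[OF l(1)] by force
  have "indicator {st l} \<in> cell {i, j}" using l(2) indicator_in_cell_pair[OF b(9)] by blast
  moreover have "level i j s (indicator {st l}) \<le> t" "t \<le> level i j s' (indicator {st l})"
    using l(2) 1 2 b(9) by auto
  moreover have "indicator {st l} i = (0::real) \<or> indicator {st l} j = (0::real)"
    using b(9) by (auto simp: indicator_def)
  ultimately show "p \<in> closed_block_face i j s s' - block_face i j s s'"
    using t(1) in_block_face[OF assms(1)] in_closed_block_face[OF assms(1)] by auto
qed

text \<open>
  A boundary point of the slab lies over an end of the edge, where vertical arrows cover it, or
  on one of the two bounding segments.
\<close>

lemma block_boundary_covered:
  assumes "block i j s s'" "p \<in> closed_block_face i j s s' - block_face i j s s'"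
  shows "\<exists>a\<in>block_arrows i j s s'. p \<in> img a"
proof -
  note b = blockD[OF assms(1)]
  obtain x t where xt: "p = (x, t)" by force
  have x: "x \<in> cell {i, j}" "level i j s x \<le> t" "t \<le> level i j s' x"
    using assms(2) xt in_closed_block_face[OF assms(1)] by auto
  have on_slanted: ?thesis if "c = s \<or> c = s'" "t = level i j c x" for c
  proof -
    have "(x, t) \<in> img (cut_arrow i j c)"
      using that x(1) b(2,3) img_cut_arrow[OF b(1), of c] by (auto simp: slanted_segment_def)
    then show ?thesis using that(1) xt by (auto simp: block_arrows_def)
  qed
  have on_string: ?thesis if k: "x = indicator {k}" "k \<in> {i, j}" for k
  proof -
    have "k \<in> {1..r}" "ht (latest k s) \<le> t" "t \<le> ht (latest k s')"
      using k x b(7-9) by auto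
    then consider "t = ht (latest k s)"
      | l where "l \<in> {1..N}" "st l = k" "s < l" "l \<le> s'" "ht (prv l) \<le> t" "t \<le> ht l"
      using string_covered[OF _ b(5) less_imp_le[OF b(4)]] by blast
    then show ?thesis
    proof cases
      case 1
      then show ?thesis using on_slanted[of s] k b(9) by auto
    next
      case 2
      then have "p \<in> img (vertical_arrow l)" using img_vertical_arrow[of l] xt k by simp
      moreover have "vertical_arrow l \<in> block_arrows i j s s'" using 2 k by (auto simp: block_arrows_def positions_def)
      ultimately show ?thesis by blast
    qed
  qed
  have "x i \<ge> 0" "x j \<ge> 0" using x(1) b(9) by (auto simp: cell_pair_iff)
  then consider "x i = 0" | "x j = 0" | "0 < x i" "0 < x j" by linarith
  then show ?thesis
  proof cases
    case 1
    then show ?thesis using on_string[of j] cell_pair_ends(1)[OF b(9) x(1)] by auto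
  next
    case 2
    then show ?thesis using on_string[of i] cell_pair_ends(2)[OF b(9) x(1)] by auto
  next
    case 3
    then have "t = level i j s x \<or> t = level i j s' x"
      using assms(2) x xt in_block_face[OF assms(1), of x t] by auto
    then show ?thesis using on_slanted by blast
  qed
qed

lemma block_boundary_union:
  assumes "block i j s s'"
  shows "closed_block_face i j s s' - block_face i j s s' = (\<Union>a\<in>block_arrows i j s s'. img a)"
proof
  show "closed_block_face i j s s' - block_face i j s s' \<subseteq> (\<Union>a\<in>block_arrows i j s s'. img a)"
    using block_boundary_covered[OF assms] by blast
  have "img a \<subseteq> closed_block_face i j s s' - block_face i j s s'" if "a \<in> block_arrows i j s s'" for a
    using that slanted_in_block_boundary[OF assms] vertical_in_block_boundary[OF assms]
    unfolding block_arrows_def by blast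
  then show "(\<Union>a\<in>block_arrows i j s s'. img a) \<subseteq> closed_block_face i j s s' - block_face i j s s'" by blast
qed

lemma boundary_block_face:
  assumes "block i j s s'"
  shows "boundary (block_face i j s s') = closed_block_face i j s s' - block_face i j s s'"
  unfolding boundary_def
  by (rule slab.frontier_of_open_slab[OF blockD(10)[OF assms] blockD(1)[OF assms] edge_card])

text \<open>
  An arrow inside the closed slab lies in the right range of heights: a vertical one by comparing
  its two ends with the corners, a slanted one by comparing levels over an interior point of the
  edge, which leaves only the two cuts of the block.
\<close>

lemma boundary_arcs_block_face:
  assumes "block i j s s'"
  shows "boundary_arcs (block_face i j s s') = block_arrows i j s s'"
proof (intro equalityI subsetI)
  fix a assume "a \<in> block_arrows i j s s'"
  then show "a \<in> boundary_arcs (block_face i j s s')"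
    using block_boundary_union[OF assms] boundary_block_face[OF assms] block_arrows_subset_arcs[OF assms]
    unfolding boundary_arcs_def by blast
next
  note b = blockD[OF assms]
  fix a assume "a \<in> boundary_arcs (block_face i j s s')"
  then have a: "a \<in> arcs Q" and sub: "\<And>x t. (x, t) \<in> img a \<Longrightarrow> (x, t) \<in> closed_block_face i j s s'"
    using boundary_block_face[OF assms] unfolding boundary_arcs_def by blast+
  from a show "a \<in> block_arrows i j s s'"
  proof (cases rule: arcs_cases)
    case (vertical l)
    have pl: "ht (prv l) \<le> ht l"
      using prv[OF vertical(1)] pos_in_I[OF vertical(1)] height_le_iff by auto
    then have "(indicator {st l}, ht (prv l)) \<in> img a" "(indicator {st l}, ht l) \<in> img a"
      using vertical img_vertical_arrow by auto
    then have c: "(indicator {st l}, ht (prv l)) \<in> closed_block_face i j s s'"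
      "(indicator {st l}, ht l) \<in> closed_block_face i j s s'"
      using sub by auto
    then have k: "st l \<in> {i, j}"
      using in_closed_block_face[OF assms] indicator_in_cell_pair[OF b(9)] by blast
    then have k_r: "st l \<in> {1..r}" using b by auto
    have "ht (latest (st l) s) \<le> ht (prv l)" "ht l \<le> ht (latest (st l) s')"
      using c k b(9) in_closed_block_face[OF assms] by auto
    then have "latest (st l) s \<le> prv l" "l \<le> latest (st l) s'"
      using height_le_iff latest(1)[OF k_r] b(5,6) prv(1)[OF vertical(1)]
        pos_in_I[OF vertical(1)] by blast+
    moreover have "l \<le> latest (st l) s" if "l \<le> s"
      using latest_greatest[OF pos_in_I[OF vertical(1)] that] by simp
    ultimately have "s < l" "l \<le> s'"
      using prv(2)[OF vertical(1)] latest(2)[OF k_r b(6)] by force+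
    then show ?thesis using vertical k by (auto simp: block_arrows_def positions_def)
  next
    case (slanted i' j' c)
    have ij': "i' \<noteq> j'" using slanted edge_iff by blast
    then obtain x where x: "x \<in> cell {i', j'}" "0 < x i'" "0 < x j'"
      using cell_pair_interior by blast
    have xa: "(x, level i' j' c x) \<in> img a"
      using x slanted img_cut_arrow by (auto simp: slanted_segment_def)
    then have xc: "x \<in> cell {i, j}" using sub in_closed_block_face[OF assms] by blast
    have eq: "{i, j} = {i', j'}"
      using cell_meeting_open_edge[OF ij' edge_card[OF b(1)] x(1) xc x(2,3)] .
    note c = cut_arrow_edge_cong[OF b(1) eq[symmetric] slanted(2)]
    have pos: "0 < x i" "0 < x j" using x(2,3) eq by (auto simp: doubleton_eq_iff)
    obtain c' where c': "c' \<in> cuts i j" "a = cut_arrow i j c'"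
      "level i' j' c x = level i j c' x"
      using arrow_in_open_strip[OF a xa b(1) xc pos] .
    have "level i j s x \<le> level i j c' x" "level i j c' x \<le> level i j s' x"
      using sub[OF xa] in_closed_block_face[OF assms] c'(3) by auto
    then have "s \<le> c'" "c' \<le> s'"
      using level_less_iff[OF b(1)] c'(1) b(2,3) pos by (meson not_le)+
    then have "c' = s \<or> c' = s'" using b(11)[OF c'(1)] by auto
    then show ?thesis using c'(2) by (auto simp: block_arrows_def)
  qed
qed

lemma face_block_face:
  assumes "block i j s s'"
  shows "face (block_face i j s s')"
proof -
  note b = blockD[OF assms]
  interpret slab i j "ht (latest i s)" "ht (latest j s)" "ht (latest i s')" "ht (latest j s')"
    by (rule b(10))
  have "closed_block_face i j s s' - block_face i j s s' \<subseteq> (\<Union>a\<in>arcs Q. img a)"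
    using block_boundary_union[OF assms] block_arrows_subset_arcs[OF assms] by blast
  then have "complement \<inter> closed_block_face i j s s' \<subseteq> block_face i j s s'" by blast
  then have "block_face i j s s' \<in> components complement"
    using block_face_subset_complement[OF assms]
    by (intro open_slab_component[OF b(1) edge_card]) (auto simp: cylinder_def)
  then show ?thesis
    unfolding face_def region_def
    using bounded_open_slab boundary_block_face[OF assms] block_boundary_union[OF assms]
      boundary_arcs_block_face[OF assms] by simp
qed

lemma face_on_strip_block_face:
  assumes "block i j s s'"
  shows "face_on_strip {i, j} (block_face i j s s')"
proof -
  interpret slab i j "ht (latest i s)" "ht (latest j s)" "ht (latest i s')" "ht (latest j s')"
    by (rule blockD(10)[OF assms])
  show ?thesis
    unfolding face_on_strip_def using face_block_face[OF assms] closure_open_slab fst_closed_slab by simp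
qed

lemma faceD:
  assumes "face F"
  shows "F \<in> components complement" "F \<subseteq> complement" "bounded F"
    and "boundary F \<subseteq> (\<Union>a\<in>arcs Q. img a)"
proof -
  show comp: "F \<in> components complement" using assms unfolding face_def region_def by blast
  then show "F \<subseteq> complement" by (rule in_components_subset)
  show "bounded F" using assms unfolding face_def by blast
  show "boundary F \<subseteq> (\<Union>a\<in>arcs Q. img a)"
    using assms unfolding face_def boundary_arcs_def by blast
qed

text \<open>
  A point of the base is a boundary point of any region containing it, because the cylinder does
  not extend below. The boundary of a face consists of arrows, which are disjoint from the region.
\<close>

lemma face_avoids_base:
  assumes "face F"
  shows "(x, 0) \<notin> F"
proof
  assume x0: "(x, 0) \<in> F"
  note F = faceD(2)[OF assms]
  let ?R = "top_of_set (realization {1..r} E \<times> (UNIV :: real set))"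
  have "(x, 0) \<notin> ?R interior_of F"
  proof
    assume "(x, 0) \<in> ?R interior_of F"
    then obtain T where T: "openin ?R T" "(x, 0) \<in> T" "T \<subseteq> F" by (auto simp: interior_of_def)
    then obtain U where U: "open U" "T = (realization {1..r} E \<times> UNIV) \<inter> U"
      by (auto simp: openin_open)
    obtain e where e: "e > 0" "ball (x, 0) e \<subseteq> U" using U T(2) openE by blast
    \<comment> \<open>a point of the two-sided cylinder just below the base\<close>
    have "(x, - e / 2) \<in> ball (x, 0) e" using e(1) by (simp add: dist_Pair_Pair)
    then have "(x, - e / 2) \<in> U" using e(2) by blast
    then have "(x, - e / 2) \<in> F" using T U(2) by blast
    then show False using F e(1) by (auto simp: cylinder_def)
  qed
  moreover have "(x, 0) \<in> ?R closure_of F"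
    using F x0 by (auto simp: cylinder_def intro!: closure_of_subset[THEN subsetD])
  ultimately have "(x, 0) \<in> boundary F" unfolding boundary_def frontier_of_def by blast
  then show False using faceD(4)[OF assms] F x0 by blast
qed

lemma face_contains_vertical:
  assumes "face F" "(x, t) \<in> F" "connected T" "t \<in> T" "{x} \<times> T \<subseteq> complement"
  shows "{x} \<times> T \<subseteq> F"
proof (rule components_maximal)
  show "F \<in> components complement" using assms(1) by (rule faceD)
  show "connected ({x} \<times> T)" using assms(3) by (simp add: connected_Times)
  show "F \<inter> {x} \<times> T \<noteq> {}" using assms by auto
qed fact

text \<open>
  Otherwise the face would contain the vertical segment down to the base.
\<close>

lemma not_clear_below:
  assumes "face F" "(x, t) \<in> F"
  shows "\<exists>t'. 0 \<le> t' \<and> t' < t \<and> (x, t') \<in> (\<Union>a\<in>arcs Q. img a)"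
proof (rule ccontr)
  assume contra: "\<not> ?thesis"
  have xt: "(x, t) \<in> complement" using faceD(2)[OF assms(1)] assms(2) by blast
  then have t: "0 \<le> t" "x \<in> realization {1..r} E" by (auto simp: cylinder_def)
  have "{x} \<times> {0..t} \<subseteq> complement"
  proof
    fix p assume "p \<in> {x} \<times> {0..t}"
    then obtain t' where t': "p = (x, t')" "0 \<le> t'" "t' \<le> t" by auto
    then show "p \<in> complement"
    proof (cases "t' = t")
      case False
      then show ?thesis using t' contra t(2) by (auto simp: cylinder_def)
    qed (use xt in simp)
  qed
  then have "{x} \<times> {0..t} \<subseteq> F"
    using t by (intro face_contains_vertical[OF assms]) auto
  moreover have "(x, 0) \<in> {x} \<times> {0..t}" using t by simp
  ultimately show False using face_avoids_base[OF assms(1)] by blast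
qed

text \<open>
  Otherwise the face would contain a vertical ray and be unbounded.
\<close>

lemma not_clear_above:
  assumes "face F" "(x, t) \<in> F"
  shows "\<exists>t'. t < t' \<and> (x, t') \<in> (\<Union>a\<in>arcs Q. img a)"
proof (rule ccontr)
  assume contra: "\<not> ?thesis"
  have xt: "(x, t) \<in> complement" using faceD(2)[OF assms(1)] assms(2) by blast
  then have t: "0 \<le> t" "x \<in> realization {1..r} E" by (auto simp: cylinder_def)
  have "{x} \<times> {t..} \<subseteq> complement"
  proof
    fix p assume "p \<in> {x} \<times> {t..}"
    then obtain t' where t': "p = (x, t')" "t \<le> t'" by auto
    then show "p \<in> complement"
    proof (cases "t' = t")
      case False
      then show ?thesis using t' contra t by (auto simp: cylinder_def)
    qed (use xt in simp)
  qed
  then have "{x} \<times> {t..} \<subseteq> F"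
    by (intro face_contains_vertical[OF assms]) (auto simp: connected_Ici)
  then have sub: "{t..} \<subseteq> snd ` F" by force
  have "bounded (snd ` F)" using faceD(3)[OF assms(1)] by (rule bounded_snd)
  then obtain B where B: "\<And>y. y \<in> {t..} \<Longrightarrow> \<bar>y\<bar> \<le> B"
    using sub unfolding bounded_iff by (metis real_norm_def subsetD)
  \<comment> \<open>a height on the ray that exceeds the bound B\<close>
  have "\<bar>max t (B + 1)\<bar> \<le> B" by (rule B) simp
  then show False by linarith
qed

lemma string_arrow_range:
  assumes "a \<in> arcs Q" "(indicator {k}, t) \<in> img a" "k \<in> {1..r}"
  shows "ht (latest k 0) \<le> t" "t \<le> ht (latest k N)"
proof -
  have vertex: "ht (latest k 0) \<le> ht v \<and> ht v \<le> ht (latest k N)" if "v \<in> I" "st v = k" for v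
  proof -
    have "latest k 0 \<le> v"
      using I_cases[OF that(1)] latest_zero[OF assms(3)] that assms(3) by auto
    moreover have "v \<le> latest k N"
      using that I_cases[OF that(1)] by (intro latest_greatest) auto
    ultimately show ?thesis using height_le_iff that latest(1)[OF assms(3)] by auto
  qed
  from assms(1,2) have "ht (latest k 0) \<le> t \<and> t \<le> ht (latest k N)"
  proof (cases rule: arrow_on_string)
    case (vertical l)
    then show ?thesis using vertex[of "prv l"] vertex[of l] prv[of l] pos_in_I[of l] by auto
  next
    case (slanted j s)
    then show ?thesis using vertex[of "latest k s"] latest[OF assms(3), of s] cuts_nonneg by auto
  qed
  then show "ht (latest k 0) \<le> t" "t \<le> ht (latest k N)" by auto
qed

text \<open>
  Take a point of the face. There are arrows below and above it. On a string this would put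
  it on a vertical arrow. So it lies in an open strip, and the highest cut below it and the lowest
  cut above it are consecutive. The slab between them is a component that meets the face.
\<close>

lemma face_is_block_face:
  assumes "face F"
  obtains i j s s' where "block i j s s'" "F = block_face i j s s'"
proof -
  note comp = faceD(1)[OF assms]
  then have F: "F \<subseteq> complement" "F \<noteq> {}"
    using in_components_subset in_components_nonempty by blast+
  then obtain x t where xt: "(x, t) \<in> F" by auto
  then have clear: "\<And>a. a \<in> arcs Q \<Longrightarrow> (x, t) \<notin> img a" and x: "x \<in> realization {1..r} E"
    using F(1) by (auto simp: cylinder_def)
  obtain t1 a1 where t1: "t1 < t" "a1 \<in> arcs Q" "(x, t1) \<in> img a1"
    using not_clear_below[OF assms xt] by blast
  obtain t2 a2 where t2: "t < t2" "a2 \<in> arcs Q" "(x, t2) \<in> img a2"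
    using not_clear_above[OF assms xt] by blast
  from x show ?thesis
  proof (cases rule: realization_cases)
    case (string k)
    have "ht (latest k 0) < t" "t < ht (latest k N)"
      using t1 t2 string_arrow_range[of a1 k t1] string_arrow_range[of a2 k t2] string by auto
    then obtain l where "l \<in> {1..N}" "st l = k" "ht (prv l) \<le> t" "t \<le> ht l"
      using string_covered[OF string(1), of 0 N t] by auto
    then have "(x, t) \<in> img (vertical_arrow l)" "vertical_arrow l \<in> arcs Q"
      using img_vertical_arrow string(2) vertical_arrow_in_arcs by auto
    then show ?thesis using clear by blast
  next
    case (strip i j)
    obtain c1 where c1: "c1 \<in> cuts i j" "t1 = level i j c1 x"
      using arrow_in_open_strip[OF t1(2,3) strip] .
    obtain c2 where c2: "c2 \<in> cuts i j" "t2 = level i j c2 x"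
      using arrow_in_open_strip[OF t2(2,3) strip] .
    define D where "D = {c \<in> cuts i j. level i j c x < t}"
    have D: "finite D" "D \<noteq> {}" using finite_cuts c1 t1(1) by (auto simp: D_def)
    define s where "s = Max D"
    have s: "s \<in> cuts i j" "level i j s x < t" using Max_in[OF D] by (auto simp: s_def D_def)
    define D' where "D' = {c \<in> cuts i j. t < level i j c x}"
    have D': "finite D'" "D' \<noteq> {}" using finite_cuts c2 t2(1) by (auto simp: D'_def)
    define s' where "s' = Min D'"
    have s': "s' \<in> cuts i j" "t < level i j s' x" using Min_in[OF D'] by (auto simp: s'_def D'_def)
    have "s < s'" using level_less_iff[OF strip(1) s(1) s'(1) strip(3,4)] s s' by linarith
    moreover have "c \<notin> {s<..<s'}" if c: "c \<in> cuts i j" for c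
    proof
      assume c': "c \<in> {s<..<s'}"
      have "(x, level i j c x) \<in> img (cut_arrow i j c)"
        using img_cut_arrow[OF strip(1) c] strip(2) by (simp add: slanted_segment_def)
      then have "t \<noteq> level i j c x" using clear cut_arrow_in_arcs[OF strip(1) c] by blast
      then have "c \<in> D \<or> c \<in> D'" using c by (auto simp: D_def D'_def)
      then show False
        using Max_ge[OF D(1), of c] Min_le[OF D'(1), of c] c' by (auto simp: s_def s'_def)
    qed
    ultimately have block: "block i j s s'" using strip(1) s s' by (auto simp: block_def)
    have "(x, t) \<in> block_face i j s s'" using in_block_face[OF block] strip s s' by simp
    moreover have "block_face i j s s' \<in> components complement"
      using face_block_face[OF block] by (rule faceD)
    ultimately have "F = block_face i j s s'" using components_nonoverlap[OF comp] xt by blast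
    then show ?thesis using that block by blast
  qed
qed

lemma face_on_edge:
  assumes "face_on_strip {i, j} F" "{i, j} \<in> E"
  obtains s s' where "block i j s s'" "F = block_face i j s s'"
proof -
  obtain i' j' s s' where b: "block i' j' s s'" "F = block_face i' j' s s'"
    using face_is_block_face assms(1) unfolding face_on_strip_def by metis
  have "cell {i', j'} = cell {i, j}"
    using face_on_strip_block_face[OF b(1)] assms(1) b(2) unfolding face_on_strip_def by blast
  then have "{i', j'} = {i, j}"
    using cell_eq_iff edge_card[OF assms(2)] edge_card[OF blockD(1)[OF b(1)]] by blast
  then consider "i' = i" "j' = j" | "i' = j" "j' = i" by (auto simp: doubleton_eq_iff)
  then show ?thesis
  proof cases
    case 1
    then show ?thesis using that b by blast
  next
    case 2
    then show ?thesis using that[of s s'] b block_commute block_face_commute by simp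
  qed
qed


subsection \<open>Orientation\<close>

text \<open>
  The vertical arrows over j that belong to positive letters form a path, built from the top by
  prepending the arrow of the lowest letter.
\<close>

lemma ascending_walk:
  assumes "j \<in> {1..r}" "s \<le> s'" "0 \<le> s"
    and "\<And>l. l \<in> {1..N} \<Longrightarrow> s < l \<Longrightarrow> l \<le> s' \<Longrightarrow> st l = j \<Longrightarrow> 0 < letter w l"
  shows "\<exists>p. awalk (latest j s) p (latest j s') \<and>
    set p = vertical_arrow ` {l \<in> {1..N}. s < l \<and> l \<le> s' \<and> st l = j} \<and>
    distinct (awalk_verts (latest j s) p) \<and>
    set (awalk_verts (latest j s) p) \<subseteq> {k. st k = j \<and> latest j s \<le> k}"
  using assms(2-4)
proof (induction s rule: int_le_induct)
  case base
  have "{l \<in> {1..N}. s' < l \<and> l \<le> s' \<and> st l = j} = {}" by auto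
  then show ?case
    using latest[OF assms(1) base(1)]
    by (intro exI[of _ "[]"]) (simp add: awalk_Nil_iff bfz_quiver_simps)
next
  case (step s)
  have s: "0 \<le> s" using step.prems by simp
  have "0 < letter w l" if "l \<in> {1..N}" "s < l" "l \<le> s'" "st l = j" for l
    using step.prems(2)[of l] that by simp
  then obtain p where p: "awalk (latest j s) p (latest j s')"
    "set p = vertical_arrow ` {l \<in> {1..N}. s < l \<and> l \<le> s' \<and> st l = j}"
    "distinct (awalk_verts (latest j s) p)"
    "set (awalk_verts (latest j s) p) \<subseteq> {k. st k = j \<and> latest j s \<le> k}"
    using step.IH[OF s] by blast
  show ?case
  proof (cases "s \<in> {1..N} \<and> st s = j")
    case True
    then have eq: "latest j s = s" "prv s = latest j (s - 1)" using latest_self[of s] by auto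
    have v: "vertical_arrow s = Vertical (latest j (s - 1)) s"
      using step.prems(2)[of s] True step.hyps eq by (simp add: vertical_arrow_def)
    have lt: "latest j (s - 1) < s" using latest(2)[OF assms(1) step.prems(1)] by simp
    have "{l \<in> {1..N}. s - 1 < l \<and> l \<le> s' \<and> st l = j} =
        insert s {l \<in> {1..N}. s < l \<and> l \<le> s' \<and> st l = j}"
      using True step.hyps by auto
    then have "set (vertical_arrow s # p) = vertical_arrow ` {l \<in> {1..N}. s - 1 < l \<and> l \<le> s' \<and> st l = j}"
      using p(2) by simp
    moreover have "awalk (latest j (s - 1)) (vertical_arrow s # p) (latest j s')"
      using p(1) vertical_arrow_in_arcs[of s] True eq v by (simp add: awalk_Cons_iff bfz_quiver_simps)
    moreover have "awalk_verts (latest j (s - 1)) (vertical_arrow s # p) =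
        latest j (s - 1) # awalk_verts (latest j s) p"
      using v eq by (simp add: bfz_quiver_simps)
    moreover have "latest j (s - 1) \<notin> set (awalk_verts (latest j s) p)"
      using p(4) lt eq by auto
    moreover have "set (awalk_verts (latest j s) p) \<subseteq> {k. st k = j \<and> latest j (s - 1) \<le> k}"
      using p(4) lt eq by auto
    ultimately show ?thesis
      using p(3) latest(3)[OF assms(1) step.prems(1)]
      by (intro exI[of _ "vertical_arrow s # p"]) simp
  next
    case False
    then have "st l \<noteq> j" if "l \<in> {1..N}" "s - 1 < l" "l \<le> s" for l
      using that by (cases "l = s") auto
    then have "latest j s = latest j (s - 1)"
      by (intro latest_constant assms(1) step.prems(1)) auto
    moreover have "s - 1 < l \<and> st l = j \<longleftrightarrow> s < l \<and> st l = j" if "l \<in> {1..N}" for l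
      using that False by (cases "l = s") auto
    then have "{l \<in> {1..N}. s - 1 < l \<and> l \<le> s' \<and> st l = j} =
        {l \<in> {1..N}. s < l \<and> l \<le> s' \<and> st l = j}"
      by blast
    ultimately show ?thesis using p by auto
  qed
qed

lemma descending_walk:
  assumes "i \<in> {1..r}" "s \<le> s'" "0 \<le> s"
    and "\<And>l. l \<in> {1..N} \<Longrightarrow> s < l \<Longrightarrow> l \<le> s' \<Longrightarrow> st l = i \<Longrightarrow> \<not> 0 < letter w l"
  shows "\<exists>p. awalk (latest i s') p (latest i s) \<and>
    set p = vertical_arrow ` {l \<in> {1..N}. s < l \<and> l \<le> s' \<and> st l = i} \<and>
    distinct (awalk_verts (latest i s') p) \<and>
    set (awalk_verts (latest i s') p) \<subseteq> {k. st k = i \<and> k \<le> latest i s'}"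
  using assms(2,4)
proof (induction s' rule: int_ge_induct)
  case base
  have "{l \<in> {1..N}. s < l \<and> l \<le> s \<and> st l = i} = {}" by auto
  then show ?case
    using latest[OF assms(1,3)]
    by (intro exI[of _ "[]"]) (simp add: awalk_Nil_iff bfz_quiver_simps)
next
  case (step s')
  let ?t = "s' + 1"
  have s': "0 \<le> s'" using step.hyps assms(3) by simp
  have "\<not> 0 < letter w l" if "l \<in> {1..N}" "s < l" "l \<le> s'" "st l = i" for l
    using step.prems[of l] that by simp
  then obtain p where p: "awalk (latest i s') p (latest i s)"
    "set p = vertical_arrow ` {l \<in> {1..N}. s < l \<and> l \<le> s' \<and> st l = i}"
    "distinct (awalk_verts (latest i s') p)"
    "set (awalk_verts (latest i s') p) \<subseteq> {k. st k = i \<and> k \<le> latest i s'}"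
    using step.IH by blast
  show ?case
  proof (cases "?t \<in> {1..N} \<and> st ?t = i")
    case True
    then have eq: "latest i ?t = ?t" "prv ?t = latest i s'" using latest_self[of ?t] by auto
    have v: "vertical_arrow ?t = Vertical ?t (latest i s')"
      using step.prems[of ?t] True step.hyps eq by (simp add: vertical_arrow_def)
    have lt: "latest i s' < ?t" using latest(2)[OF assms(1) s'] by simp
    have "{l \<in> {1..N}. s < l \<and> l \<le> ?t \<and> st l = i} =
        insert ?t {l \<in> {1..N}. s < l \<and> l \<le> s' \<and> st l = i}"
      using True step.hyps by auto
    then have "set (vertical_arrow ?t # p) = vertical_arrow ` {l \<in> {1..N}. s < l \<and> l \<le> ?t \<and> st l = i}"
      using p(2) by simp
    moreover have "awalk (latest i ?t) (vertical_arrow ?t # p) (latest i s)"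
      using p(1) vertical_arrow_in_arcs[of ?t] True eq v by (simp add: awalk_Cons_iff bfz_quiver_simps)
    moreover have "awalk_verts (latest i ?t) (vertical_arrow ?t # p) = ?t # awalk_verts (latest i s') p"
      using v by (simp add: bfz_quiver_simps)
    moreover have "?t \<notin> set (awalk_verts (latest i s') p)"
      using p(4) lt by auto
    moreover have "set (awalk_verts (latest i s') p) \<subseteq> {k. st k = i \<and> k \<le> latest i ?t}"
      using p(4) lt eq by auto
    ultimately show ?thesis
      using p(3) eq True by (intro exI[of _ "vertical_arrow ?t # p"]) simp
  next
    case False
    then have "latest i ?t = latest i s'"
      using s' assms(1) by (intro latest_constant) (auto simp: zle_add1_eq_le order_antisym_conv)
    moreover have "{l \<in> {1..N}. s < l \<and> l \<le> ?t \<and> st l = i} =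
        {l \<in> {1..N}. s < l \<and> l \<le> s' \<and> st l = i}"
      using False by (auto simp: order_le_less zless_add1_eq)
    ultimately show ?thesis using p by auto
  qed
qed

text \<open>
  The cycle crosses from i to j at the bottom, climbs along j, crosses back at the top and descends
  along i. Its vertices are distinct because the two strings are disjoint.
\<close>

lemma block_arrows_upward_cycle:
  assumes "block i j s s'" and up: "upward j s'"
  shows "\<exists>p. cycle p \<and> set p = block_arrows i j s s'"
proof -
  note b = blockD[OF assms(1)] and ends = block_cut_arrow_ends[OF assms]
  have sign: "0 < letter w l \<longleftrightarrow> st l = j" if "l \<in> {1..N}" "st l \<in> {i, j}" "s < l" "l \<le> s'" for l
    using block_upward[OF assms(1), of l] that up by (auto simp: positions_def upward_def)
  obtain p where p: "awalk (latest j s) p (latest j s')"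
    "set p = vertical_arrow ` {l \<in> {1..N}. s < l \<and> l \<le> s' \<and> st l = j}"
    "distinct (awalk_verts (latest j s) p)" "set (awalk_verts (latest j s) p) \<subseteq> {k. st k = j}"
    using ascending_walk[OF b(8) less_imp_le[OF b(4)] b(5)] sign by blast
  obtain q where q: "awalk (latest i s') q (latest i s)"
    "set q = vertical_arrow ` {l \<in> {1..N}. s < l \<and> l \<le> s' \<and> st l = i}"
    "distinct (awalk_verts (latest i s') q)" "set (awalk_verts (latest i s') q) \<subseteq> {k. st k = i}"
    using descending_walk[OF b(7) less_imp_le[OF b(4)] b(5)] sign b(9) by blast
  let ?c = "cut_arrow i j s" and ?c' = "cut_arrow i j s'"
  have c: "?c \<in> arcs Q" "tail Q ?c = latest i s" "head Q ?c = latest j s"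
    and c': "?c' \<in> arcs Q" "tail Q ?c' = latest j s'" "head Q ?c' = latest i s'"
    using ends cut_arrow_in_arcs b(1-3) by (simp_all add: bfz_quiver_simps)
  have pq: "awalk (latest j s) (p @ ?c' # q) (latest i s)"
    using p(1) q(1) c' by (intro awalk_appendI[OF p(1)]) (simp add: awalk_Cons_iff)
  then have "awalk (latest i s) (?c # p @ ?c' # q) (latest i s)"
    using c by (subst awalk_Cons_iff) simp
  moreover have "tl (awalk_verts (latest i s) (?c # p @ ?c' # q)) =
      awalk_verts (latest j s) p @ awalk_verts (latest i s') q"
    using awalk_verts_append[OF pq] c c' by simp
  then have "distinct (tl (awalk_verts (latest i s) (?c # p @ ?c' # q)))"
    using p(3,4) q(3,4) b(9) by auto
  ultimately have "cycle (?c # p @ ?c' # q)" unfolding cycle_def by blast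
  moreover have "set (?c # p @ ?c' # q) = block_arrows i j s s'"
    using p(2) q(2) by (auto simp: block_arrows_def positions_def)
  ultimately show ?thesis by blast
qed

lemma oriented_block_face:
  assumes "block i j s s'"
  shows "oriented (block_face i j s s')"
proof -
  have "\<exists>p. cycle p \<and> set p = block_arrows i j s s'"
  proof (cases "upward j s'")
    case True
    then show ?thesis using block_arrows_upward_cycle[OF assms] by blast
  next
    case False
    then have "upward i s'" using upward_swap[OF blockD(9)[OF assms] block_end[OF assms]] by simp
    then show ?thesis
      using block_arrows_upward_cycle[OF block_commute[OF assms]] block_arrows_commute[OF assms] by simp
  qed
  then show ?thesis unfolding oriented_def boundary_arcs_block_face[OF assms] .
qed

subsection \<open>Extreme vertices and faces\<close>

lemma neg_frozen: "k \<in> I \<Longrightarrow> k \<le> 0 \<Longrightarrow> k \<in> bfz_frozen r w"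
  by (auto simp: bfz_frozen_def exchangeable_def)

text \<open>
  Nothing follows the last vertex of a string, so its next index exceeds the length of the
  word.
\<close>

lemma latest_N_frozen:
  assumes "i \<in> {1..r}"
  shows "latest i N \<in> bfz_frozen r w"
proof -
  note l = latest[OF assms of_nat_0_le_iff, of "length w"]
  note n = next_index[OF l(1)]
  have "\<not> nx (latest i N) \<le> N"
  proof
    assume le: "nx (latest i N) \<le> N"
    then have "nx (latest i N) \<le> latest i N"
      using n l by (intro latest_greatest pos_in_I) auto
    then show False using n(1) by simp
  qed
  then show ?thesis using l(1) by (auto simp: bfz_frozen_def exchangeable_def)
qed

lemma first_vertex:
  assumes "v \<in> I" "\<And>u. u \<in> I \<Longrightarrow> st u = st v \<Longrightarrow> ht v \<le> ht u"
  shows "v \<in> bfz_frozen r w"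
proof -
  have i: "st v \<in> {1..r}" using st_in[OF assms(1)] .
  have "v \<le> - int (st v)"
    using assms(2)[OF neg_in_I[OF i] st_neg[OF i]] height_le_iff[OF assms(1) neg_in_I[OF i]] by simp
  then show ?thesis using neg_frozen[OF assms(1)] by simp
qed

lemma last_vertex:
  assumes "v \<in> I" "\<And>u. u \<in> I \<Longrightarrow> st u = st v \<Longrightarrow> ht u \<le> ht v"
  shows "v \<in> bfz_frozen r w"
proof -
  have i: "st v \<in> {1..r}" using st_in[OF assms(1)] .
  note l = latest[OF i of_nat_0_le_iff, of "length w"]
  have "latest (st v) N \<le> v" using assms(2)[OF l(1,3)] height_le_iff[OF l(1) assms(1)] by simp
  moreover have "v \<le> latest (st v) N"
    using I_cases[OF assms(1)] assms(1) by (intro latest_greatest) auto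
  ultimately show ?thesis using latest_N_frozen[OF i] by simp
qed

lemma below_block_face:
  assumes "block i j s s'" "block i j t t'" "s' \<le> t"
  shows "below (block_face i j s s') (block_face i j t t')"
  unfolding below_def
proof (intro allI impI)
  fix x a c assume "(x, a) \<in> block_face i j s s'" "(x, c) \<in> block_face i j t t'"
  then have "x \<in> cell {i, j}" "a < level i j s' x" "level i j t x < c"
    using in_block_face[OF assms(1)] in_block_face[OF assms(2)] by auto
  then show "a < c"
    using level_mono[OF blockD(1,6)[OF assms(1)] assms(3), of x] by simp
qed

text \<open>
  Two pairs of consecutive cuts are either equal or do not overlap.
\<close>

lemma blocks_separated:
  assumes "block i j s s'" "block i j t t'" "block_face i j s s' \<noteq> block_face i j t t'"
  shows "s' \<le> t \<or> t' \<le> s"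
proof (rule ccontr)
  assume contra: "\<not> ?thesis"
  note b = blockD[OF assms(1)] and c = blockD[OF assms(2)]
  have "t \<le> s" "t' \<ge> s'" "s \<le> t" "s' \<ge> t'"
    using contra b(11)[OF c(2)] b(11)[OF c(3)] c(11)[OF b(2)] c(11)[OF b(3)] b(4) c(4) by linarith+
  then show False using assms(3) by simp
qed

lemma strip_with_face_has_cuts:
  assumes "block i j s s'"
  shows "0 \<in> cuts i j" "Max (positions i j) \<in> cuts i j" "0 < Max (positions i j)"
  using extreme_cuts[of i j] block_end[OF assms] latest_Max(3)[OF blockD(7,8)[OF assms]] by auto

lemma frozen_arrow_cut_arrow:
  assumes "block i j s s'" "c = s \<or> c = s'"
    and "latest i c \<in> bfz_frozen r w" "latest j c \<in> bfz_frozen r w"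
  shows "has_frozen_arrow (block_face i j s s')"
proof -
  have "cut_arrow i j c \<in> block_arrows i j s s'" using assms(2) by (auto simp: block_arrows_def)
  moreover have "tail Q (cut_arrow i j c) \<in> bfz_frozen r w" "head Q (cut_arrow i j c) \<in> bfz_frozen r w"
    using cut_arrow_ends[of i j c] assms(3,4) by (auto simp: bfz_quiver_simps doubleton_eq_iff)
  ultimately show ?thesis
    unfolding has_frozen_arrow_def boundary_arcs_block_face[OF assms(1)] by blast
qed

text \<open>
  The face above the bottom arrow comes first, and that arrow joins two negative indices.
\<close>

lemma first_face_exists:
  assumes "e \<in> E" "face_on_strip e F"
  shows "\<exists>G. first_face e G \<and> has_frozen_arrow G"
proof -
  obtain i j where e: "e = {i, j}" using edge_cases[OF assms(1)] by blast
  obtain s s' where b: "block i j s s'" using face_on_edge assms unfolding e by metis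
  note cuts = strip_with_face_has_cuts[OF b]
  define C where "C = {c \<in> cuts i j. 0 < c}"
  have C: "finite C" "C \<noteq> {}" using finite_cuts cuts by (auto simp: C_def)
  \<comment> \<open>the end of the lowest block, the next cut after the bottom\<close>
  define m where "m = Min C"
  have m: "m \<in> cuts i j" "0 < m" using Min_in[OF C] by (auto simp: m_def C_def)
  have m_le: "m \<le> c" if "c \<in> cuts i j" "0 < c" for c
    using Min_le[OF C(1), of c] that by (simp add: m_def C_def)
  have block: "block i j 0 m" using blockD(1)[OF b] cuts(1) m m_le by (force simp: block_def)
  have "below (block_face i j 0 m) G" if G: "face_on_strip e G" "G \<noteq> block_face i j 0 m" for G
  proof -
    obtain t t' where t: "block i j t t'" "G = block_face i j t t'"
      using face_on_edge[of i j G] G(1) assms(1) unfolding e by blast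
    have "m \<le> t \<or> t' \<le> 0" using blocks_separated[OF block t(1)] G(2) t(2) by blast
    then have "m \<le> t" using blockD(4,5)[OF t(1)] by simp
    then show ?thesis using below_block_face[OF block t(1)] t(2) by simp
  qed
  then have "first_face e (block_face i j 0 m)"
    unfolding first_face_def using face_on_strip_block_face[OF block] e by blast
  moreover have "has_frozen_arrow (block_face i j 0 m)"
    using block blockD(7,8)[OF block] neg_frozen latest[of _ 0]
    by (intro frozen_arrow_cut_arrow[of i j 0 m 0]) auto
  ultimately show ?thesis by blast
qed

text \<open>
  The face below the top arrow comes last, and that arrow joins the last vertices of two
  strings.
\<close>

lemma last_face_exists:
  assumes "e \<in> E" "face_on_strip e F"
  shows "\<exists>G. last_face e G \<and> has_frozen_arrow G"
proof -
  obtain i j where e: "e = {i, j}" using edge_cases[OF assms(1)] by blast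
  obtain s s' where b: "block i j s s'" using face_on_edge assms unfolding e by metis
  let ?M = "Max (positions i j)"
  note cuts = strip_with_face_has_cuts[OF b]
  define C where "C = {c \<in> cuts i j. c < ?M}"
  have C: "finite C" "C \<noteq> {}" using finite_cuts cuts by (auto simp: C_def)
  define m where "m = Max C"
  have m: "m \<in> cuts i j" "m < ?M" using Max_in[OF C] by (auto simp: m_def C_def)
  have m_ge: "c \<le> m" if "c \<in> cuts i j" "c < ?M" for c
    using Max_ge[OF C(1), of c] that by (simp add: m_def C_def)
  have block: "block i j m ?M" using blockD(1)[OF b] cuts(2) m m_ge by (force simp: block_def)
  have "below G (block_face i j m ?M)" if G: "face_on_strip e G" "G \<noteq> block_face i j m ?M" for G
  proof -
    obtain t t' where t: "block i j t t'" "G = block_face i j t t'"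
      using face_on_edge[of i j G] G(1) assms(1) unfolding e by blast
    have "?M \<le> t \<or> t' \<le> m" using blocks_separated[OF block t(1)] G(2) t(2) by blast
    then have "t' \<le> m" using blockD(4)[OF t(1)] cuts_le_Max[OF blockD(3)[OF t(1)]] by simp
    then show ?thesis using below_block_face[OF t(1) block] t(2) by simp
  qed
  then have "last_face e (block_face i j m ?M)"
    unfolding last_face_def using face_on_strip_block_face[OF block] e by blast
  moreover have "has_frozen_arrow (block_face i j m ?M)"
  proof (intro frozen_arrow_cut_arrow[OF block, of ?M])
    note r = blockD(7,8)[OF block]
    have "positions i j \<noteq> {}" using block_end[OF b] by blast
    note M = latest_Max[OF r this]
    show "latest i ?M \<in> bfz_frozen r w" "latest j ?M \<in> bfz_frozen r w"
      using latest_N_frozen r unfolding M(1,2)[symmetric] by blast+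
  qed simp
  ultimately show ?thesis by blast
qed

subsection \<open>Arrows shared by two faces\<close>

lemma vertical_arrow_inj: "l \<in> {1..N} \<Longrightarrow> m \<in> {1..N} \<Longrightarrow> vertical_arrow l = vertical_arrow m \<Longrightarrow> l = m"
  using prv(2)[of l] prv(2)[of m] by (auto simp: vertical_arrow_def split: if_splits)

lemma vertical_arrow_neq_cut_arrow: "vertical_arrow l \<noteq> cut_arrow i j s"
  by (simp add: vertical_arrow_def cut_arrow_def)

lemma cut_arrow_strands:
  assumes "{i, j} \<in> E" "0 \<le> s"
  shows "{st (arrow_tail (cut_arrow i j s)), st (arrow_head (cut_arrow i j s))} = {i, j}"
proof -
  have "i \<in> {1..r}" "j \<in> {1..r}" using assms edge_iff by auto
  then have "st ` {arrow_tail (cut_arrow i j s), arrow_head (cut_arrow i j s)} = {i, j}"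
    unfolding cut_arrow_ends using latest(3) assms(2) by simp
  then show ?thesis by simp
qed

lemma cut_arrow_inj:
  assumes "{i, j} \<in> E" "s \<in> cuts i j" "t \<in> cuts i j" "cut_arrow i j s = cut_arrow i j t"
  shows "s = t"
proof -
  have r: "i \<in> {1..r}" "j \<in> {1..r}" "i \<noteq> j" using assms edge_iff by auto
  have st: "0 \<le> s" "0 \<le> t" using assms cuts_nonneg by auto
  have "{latest i s, latest j s} = {latest i t, latest j t}"
    using cut_arrow_ends[of i j s] cut_arrow_ends[of i j t] assms(4) by simp
  then have "latest i s = latest i t" "latest j s = latest j t"
    using latest(3)[OF r(1) st(1)] latest(3)[OF r(2) st(1)]
      latest(3)[OF r(1) st(2)] latest(3)[OF r(2) st(2)] r(3) by (metis doubleton_eq_iff)+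
  then show ?thesis using latest_cuts_inj[OF r(1,2) assms(2,3)] by blast
qed

lemma block_arrows_cases:
  assumes "block i j s s'" "a \<in> block_arrows i j s s'"
  obtains (slanted) c where "c = s \<or> c = s'" "c \<in> cuts i j" "0 \<le> c" "a = cut_arrow i j c"
  | (vertical) l where "l \<in> {1..N}" "st l \<in> {i, j}" "s < l" "l \<le> s'" "a = vertical_arrow l"
  using assms(2) blockD[OF assms(1)] unfolding block_arrows_def positions_def by blast

text \<open>
  Blocks of one strip consist of disjoint sets of letters, so only the cut between them can be
  common to both.
\<close>

lemma same_strip_shared_arrow:
  assumes "block i j s s'" "block i j t t'" "s' \<le> t" "a \<in> block_arrows i j s s'" "a \<in> block_arrows i j t t'"
  shows "a = cut_arrow i j s'"
  using assms(1,4)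
proof (cases rule: block_arrows_cases)
  case c: (slanted c)
  from assms(2,5) show ?thesis
  proof (cases rule: block_arrows_cases)
    case (slanted d)
    then have "c = d" using cut_arrow_inj[OF blockD(1)[OF assms(1)]] c by simp
    then have "c = s'"
      using c slanted blockD(4)[OF assms(1)] blockD(4)[OF assms(2)] assms(3) by auto
    then show ?thesis using c by simp
  next
    case (vertical l)
    then show ?thesis using c vertical_arrow_neq_cut_arrow by metis
  qed
next
  case l: (vertical l)
  from assms(2,5) show ?thesis
  proof (cases rule: block_arrows_cases)
    case (slanted d)
    then show ?thesis using l vertical_arrow_neq_cut_arrow by metis
  next
    case (vertical m)
    then have "l = m" using l vertical_arrow_inj by simp
    then show ?thesis using l vertical assms(3) by simp
  qed
qed

text \<open>
  A slanted arrow determines its strip, so only vertical arrows on the common string can be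
  shared.
\<close>

lemma different_strips_shared_arrow:
  assumes "block i j s s'" "block i' j' t t'" "{i, j} \<noteq> {i', j'}"
    and "a \<in> block_arrows i j s s'" "a \<in> block_arrows i' j' t t'"
  obtains l where "l \<in> {1..N}" "a = vertical_arrow l" "st l \<in> {i, j} \<inter> {i', j'}"
    "s < l" "l \<le> s'" "t < l" "l \<le> t'"
  using assms(1,4)
proof (cases rule: block_arrows_cases)
  case c: (slanted c)
  from assms(2,5) show ?thesis
  proof (cases rule: block_arrows_cases)
    case (slanted d)
    then show ?thesis
      using cut_arrow_strands[OF blockD(1)[OF assms(1)] c(3)]
        cut_arrow_strands[OF blockD(1)[OF assms(2)] slanted(3)] c(4) assms(3) by simp
  next
    case (vertical l)
    then show ?thesis using c vertical_arrow_neq_cut_arrow by metis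
  qed
next
  case l: (vertical l)
  from assms(2,5) show ?thesis
  proof (cases rule: block_arrows_cases)
    case (slanted d)
    then show ?thesis using l vertical_arrow_neq_cut_arrow by metis
  next
    case (vertical m)
    then have "l = m" using l vertical_arrow_inj by simp
    then show ?thesis using that[of l] l vertical by auto
  qed
qed

text \<open>
  The \<open>separated\<close> property for positions in place of a decomposition of the word.
\<close>

lemma separated_index:
  assumes "l \<in> {1..N}" "n \<in> {1..N}" "prv n = l" "letter w l = letter w n"
  shows "\<exists>p. l < p \<and> p < n \<and> sgn (letter w p) = sgn (letter w l) \<and> A (st l) (st p) < 0"
proof -
  \<comment> \<open>positions count from 1, list indices from 0\<close>
  define a b where "a = nat l - 1" and "b = nat n - 1"
  define m where "m = take (b - Suc a) (drop (Suc a) w)"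
  have ab: "l = int a + 1" "n = int b + 1" "a < b" "b < length w"
    using assms prv(2)[OF assms(2)] by (auto simp: a_def b_def)
  have letter: "letter w (int k + 1) = w ! k" for k by (simp add: letter_def nat_add_distrib)
  have eq: "w ! a = w ! b" using assms(4) letter ab by simp
  have m_nth: "m ! k = w ! (Suc a + k)" "Suc a + k < b" if "k < length m" for k
    using that ab by (auto simp: m_def)
  have "w = take a w @ w ! a # drop (Suc a) w" using ab by (intro id_take_nth_drop) simp
  moreover have "drop (Suc a) w = m @ w ! b # drop (Suc b) w"
    using id_take_nth_drop[of "b - Suc a" "drop (Suc a) w"] ab by (simp add: m_def)
  ultimately have split: "w = take a w @ w ! a # m @ w ! a # drop (Suc b) w" using eq by simp
  have between: "st (int (Suc a + k) + 1) \<noteq> st l" if "k < length m" for k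
  proof
    let ?p = "int (Suc a + k) + 1"
    assume "st ?p = st l"
    then have "?p \<le> prv n"
      using m_nth[OF that] ab prv(3)[OF assms(2)] assms(3)
      by (intro latest_greatest pos_in_I) auto
    then show False using assms(3) ab by simp
  qed
  have "nat \<bar>d\<bar> \<noteq> nat \<bar>w ! a\<bar>" if "d \<in> set m" for d
  proof -
    obtain k where k: "k < length m" "d = m ! k" using \<open>d \<in> set m\<close> by (auto simp: in_set_conv_nth)
    then show ?thesis
      using between[OF k(1)] m_nth[OF k(1)] ab letter[of "Suc a + k"] letter[of a]
      by (simp add: st_letter)
  qed
  then have "w ! a \<notin> set m" "- (w ! a) \<notin> set m" by force+
  then obtain d where d: "d \<in> set m" "sgn d = sgn (w ! a)" "A (nat \<bar>w ! a\<bar>) (nat \<bar>d\<bar>) < 0"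
    using separated[OF split] by blast
  then obtain k where k: "k < length m" "d = m ! k" by (auto simp: in_set_conv_nth)
  let ?p = "int (Suc a + k) + 1"
  have "l < ?p" "?p < n" using m_nth[OF k(1)] ab by auto
  moreover have "letter w ?p = d" "letter w l = w ! a"
    using letter[of "Suc a + k"] letter[of a] m_nth[OF k(1)] k ab by auto
  ultimately show ?thesis using d by (intro exI[of _ ?p]) (simp add: st_letter)
qed

text \<open>
  Equally directed letters go up along one string and down along the other.
\<close>

lemma block_sign:
  assumes "block i j s s'" "l \<in> {1..N}" "st l \<in> {i, j}" "s < l" "l \<le> s'"
    and "m \<in> {1..N}" "st m \<in> {i, j}" "s < m" "m \<le> s'"
  shows "sgn (letter w l) = sgn (letter w m) \<longleftrightarrow> st l = st m"
proof -
  have "upward j l = upward j m"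
    using block_upward[OF assms(1), of l] block_upward[OF assms(1), of m] assms(2-)
    by (auto simp: positions_def)
  then show ?thesis
    using assms(3,7) letter_nonzero[OF assms(2)] letter_nonzero[OF assms(6)] blockD(9)[OF assms(1)]
    by (auto simp: upward_def sgn_if)
qed

text \<open>
  Let x have at most two neighbours, so that the two strips are all the strips at x. Take two
  consecutive letters l and n over x in both blocks; they have the same sign. Every letter over a
  neighbour of x between them lies in one of the two blocks, so it has the opposite sign. This
  contradicts \<open>separated\<close>.
\<close>

lemma two_shared_verticals_ramify:
  assumes b: "block i j s s'" "block i' j' t t'" and ne: "{i, j} \<noteq> {i', j'}"
    and x: "x \<in> {i, j}" "x \<in> {i', j'}"
    and l: "l \<in> {1..N}" "st l = x" "s < l" "t < l"
    and m: "m \<in> {1..N}" "st m = x" "m \<le> s'" "m \<le> t'" and "l < m"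
  shows "ramification E x"
proof (rule ccontr)
  assume "\<not> ramification E x"
  then have "card {e \<in> E. x \<in> e} \<le> 2" by (simp add: ramification_def)
  moreover have "{{i, j}, {i', j'}} \<subseteq> {e \<in> E. x \<in> e}" using blockD(1)[OF b(1)] blockD(1)[OF b(2)] x by auto
  moreover have "card {{i, j}, {i', j'}} = 2" using ne by simp
  moreover have "finite {e \<in> E. x \<in> e}"
    by (rule finite_subset[of _ "Pow {1..r}"]) (use edge_cases in fastforce)+
  ultimately have two: "{e \<in> E. x \<in> e} = {{i, j}, {i', j'}}"
    by (metis card_seteq)
  have lI: "l \<in> I" using pos_in_I[OF l(1)] .
  note nx = next_index[OF lI]
  have "nx l \<le> m" using nx(5)[OF pos_in_I[OF m(1)] \<open>l < m\<close>] l(2) m(2) by simp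
  then have le: "nx l \<le> N" "nx l \<le> s'" "nx l \<le> t'" using m by auto
  note n = prv_next[OF lI le(1)]
  have stn: "st (nx l) = x" using nx(4)[OF le(1)] l(2) by simp
  have window: "s < l" "l \<le> s'" "t < l" "l \<le> t'" using l m \<open>l < m\<close> by auto
  have "sgn (letter w l) = sgn (letter w (nx l))"
    using block_sign[OF b(1) l(1) _ window(1,2) n(1)] x(1) l(2) stn le(2) nx(1) window(1) by auto
  moreover have "\<bar>letter w l\<bar> = \<bar>letter w (nx l)\<bar>" using stn l(2) by (simp add: st_letter)
  ultimately have "letter w l = letter w (nx l)" by (metis mult_sgn_abs)
  then obtain p where p: "l < p" "p < nx l" "sgn (letter w p) = sgn (letter w l)" "A x (st p) < 0"
    using separated_index[OF l(1) n(1,2)] l(2) by auto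
  have p1: "p \<in> {1..N}" using p l(1) n(1) by auto
  have x_r: "x \<in> {1..r}" using st_in[OF lI] l(2) by simp
  have "x \<noteq> st p" using p(4) diagonal[OF x_r] by auto
  then have "{x, st p} \<in> E" using p(4) x_r st_in[OF pos_in_I[OF p1]] by (simp add: edge_iff)
  then have "{x, st p} \<in> {e \<in> E. x \<in> e}" by simp
  then have "{x, st p} = {i, j} \<or> {x, st p} = {i', j'}" unfolding two by simp
  then have "sgn (letter w p) = sgn (letter w l) \<longleftrightarrow> st p = st l"
  proof
    assume "{x, st p} = {i, j}"
    then show ?thesis
      using p(1,2) le window l(2) x(1) by (intro block_sign[OF b(1) p1 _ _ _ l(1)]) auto
  next
    assume "{x, st p} = {i', j'}"
    then show ?thesis
      using p(1,2) le window l(2) x(2) by (intro block_sign[OF b(2) p1 _ _ _ l(1)]) auto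
  qed
  then show False using p(3) l(2) \<open>x \<noteq> st p\<close> by simp
qed

lemma shared_arrows_on_spine:
  assumes "face F" "face G" "F \<noteq> G" "a \<noteq> b" "{a, b} \<subseteq> boundary_arcs F \<inter> boundary_arcs G"
  shows "\<exists>x e e'. e \<in> E \<and> e' \<in> E \<and> face_on_strip e F \<and> face_on_strip e' G \<and>
    e \<inter> e' = {x} \<and> ramification E x"
proof -
  obtain i j s s' where F: "block i j s s'" "F = block_face i j s s'"
    using face_is_block_face[OF assms(1)] .
  obtain i' j' t t' where G: "block i' j' t t'" "G = block_face i' j' t t'"
    using face_is_block_face[OF assms(2)] .
  have ab: "a \<in> block_arrows i j s s'" "b \<in> block_arrows i j s s'" "a \<in> block_arrows i' j' t t'" "b \<in> block_arrows i' j' t t'"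
    using assms(5) unfolding F(2) G(2) boundary_arcs_block_face[OF F(1)] boundary_arcs_block_face[OF G(1)]
    by auto
  have ne: "{i, j} \<noteq> {i', j'}"
  proof
    assume eq: "{i, j} = {i', j'}"
    have G': "block i j t t'" "G = block_face i j t t'" "block_arrows i' j' t t' = block_arrows i j t t'"
      using eq G block_commute[OF G(1)] block_face_commute[OF G(1)] block_arrows_commute[OF G(1)]
      by (auto simp: doubleton_eq_iff)
    have "s' \<le> t \<or> t' \<le> s" using blocks_separated[OF F(1) G'(1)] F(2) G'(2) assms(3) by blast
    then have "a = b"
      using same_strip_shared_arrow[OF F(1) G'(1)] same_strip_shared_arrow[OF G'(1) F(1)]
        ab G'(3) by metis
    then show False using assms(4) by simp
  qed
  obtain l where l: "l \<in> {1..N}" "a = vertical_arrow l" "st l \<in> {i, j} \<inter> {i', j'}"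
    "s < l" "l \<le> s'" "t < l" "l \<le> t'"
    using different_strips_shared_arrow[OF F(1) G(1) ne ab(1,3)] .
  obtain m where m: "m \<in> {1..N}" "b = vertical_arrow m" "st m \<in> {i, j} \<inter> {i', j'}"
    "s < m" "m \<le> s'" "t < m" "m \<le> t'"
    using different_strips_shared_arrow[OF F(1) G(1) ne ab(2,4)] .
  have lx: "st l \<in> {i, j}" "st l \<in> {i', j'}" using l(3) by auto
  have "{i, j} \<inter> {i', j'} = {st l}" using ne lx blockD(9)[OF F(1)] blockD(9)[OF G(1)] by auto
  note x = this
  then have mx: "st m = st l" using m(3) by blast
  have "l \<noteq> m" using assms(4) l(2) m(2) by auto
  then consider "l < m" | "m < l" by linarith
  then have "ramification E (st l)"
  proof cases
    case 1
    show ?thesis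
      by (rule two_shared_verticals_ramify[OF F(1) G(1) ne lx l(1) refl l(4,6) m(1) mx m(5,7) 1])
  next
    case 2
    show ?thesis
      by (rule two_shared_verticals_ramify[OF F(1) G(1) ne lx m(1) mx m(4,6) l(1) refl l(5,7) 2])
  qed
  moreover have "face_on_strip {i, j} F" "face_on_strip {i', j'} G"
    unfolding F(2) G(2) by (rule face_on_strip_block_face, fact)+
  ultimately show ?thesis
    using x blockD(1)[OF F(1)] blockD(1)[OF G(1)] by blast
qed

lemma arrow_projects:
  assumes "a \<in> arcs Q"
  shows "(\<exists>i\<in>{1..r}. fst ` img a = cell {i}) \<or> (\<exists>e\<in>E. fst ` img a = cell e)"
  using assms
proof (cases rule: arcs_cases)
  case (vertical l)
  have "ht (prv l) \<le> ht l"
    using prv[OF vertical(1)] pos_in_I[OF vertical(1)] height_le_iff by auto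
  then have "fst ` img a = cell {st l}" using img_vertical_arrow vertical by (simp add: cell_singleton)
  then show ?thesis using st_in[OF pos_in_I[OF vertical(1)]] by blast
next
  case (slanted i j s)
  then have "fst ` img a = cell {i, j}"
    using img_cut_arrow by (force simp: slanted_segment_def)
  then show ?thesis using slanted(1) by blast
qed

theorem bfz_dimer_quiver:
  "dimer_quiver Q {1..r} E (bfz_frozen r w) st ht (bfz_curve r w)"
proof
  show "\<exists>e\<in>E. face_on_strip e F" if "face F" for F
    using face_is_block_face[OF that] face_on_strip_block_face blockD(1) by metis
  show "oriented F" if "face F" for F
    using face_is_block_face[OF that] oriented_block_face by metis
  have verts: "verts Q = I" by (simp add: bfz_quiver_simps)
  show "v \<in> bfz_frozen r w"
    if "v \<in> verts Q" "\<And>u. u \<in> verts Q \<Longrightarrow> st u = st v \<Longrightarrow> ht v \<le> ht u" for v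
    using first_vertex that unfolding verts by blast
  show "v \<in> bfz_frozen r w"
    if "v \<in> verts Q" "\<And>u. u \<in> verts Q \<Longrightarrow> st u = st v \<Longrightarrow> ht u \<le> ht v" for v
    using last_vertex that unfolding verts by blast
qed (fact arrow_projects first_face_exists last_face_exists shared_arrows_on_spine)+

end

section \<open>Reduced words\<close>

lemma word_product_append: "word_product r A (a @ b) = word_product r A a \<circ> word_product r A b"
  by (induction a) (simp_all add: word_product_def comp_assoc)

lemma word_product_Cons: "word_product r A (i # b) = simple_reflection r A i \<circ> word_product r A b"
  by (simp add: word_product_def)

lemma pairing_fun_upd:
  fixes r :: nat
  assumes "i \<in> {1..r}"
  shows "(\<Sum>j=1..r. A k j * (x(i := x i - c)) j) = (\<Sum>j=1..r. A k j * x j) - A k i * (c :: int)"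
proof -
  have "(\<Sum>j=1..r. A k j * (x(i := x i - c)) j) =
      (\<Sum>j=1..r. A k j * x j - (if j = i then A k i * c else 0))"
    by (intro sum.cong) (auto simp: algebra_simps)
  also have "\<dots> = (\<Sum>j=1..r. A k j * x j) - A k i * c"
    unfolding sum_subtractf using assms by (subst sum.delta) auto
  finally show ?thesis .
qed

lemma simple_reflection_involution:
  assumes "i \<in> {1..r}" "A i i = 2"
  shows "simple_reflection r A i \<circ> simple_reflection r A i = id"
proof
  fix x
  show "(simple_reflection r A i \<circ> simple_reflection r A i) x = id x"
    unfolding simple_reflection_def comp_def pairing_fun_upd[OF assms(1)]
    by (simp add: assms(2))
qed

lemma simple_reflections_commute:
  assumes "i \<in> {1..r}" "k \<in> {1..r}" "i \<noteq> k" "A i k = 0" "A k i = 0"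
  shows "simple_reflection r A i \<circ> simple_reflection r A k =
    simple_reflection r A k \<circ> simple_reflection r A i"
proof
  fix x
  show "(simple_reflection r A i \<circ> simple_reflection r A k) x =
      (simple_reflection r A k \<circ> simple_reflection r A i) x"
    unfolding simple_reflection_def comp_def pairing_fun_upd[OF assms(1)] pairing_fun_upd[OF assms(2)]
    using assms(3) by (simp add: assms(4,5) fun_upd_twist)
qed

lemma word_product_commute:
  assumes "x \<in> {1..r}" "\<And>y. y \<in> set m \<Longrightarrow> y \<in> {1..r} \<and> y \<noteq> x \<and> A x y = 0 \<and> A y x = 0"
  shows "word_product r A m \<circ> simple_reflection r A x =
    simple_reflection r A x \<circ> word_product r A m"
  using assms(2)
proof (induction m)
  case Nil
  then show ?case by (simp add: word_product_def)
next
  case (Cons y m)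
  have "word_product r A (y # m) \<circ> simple_reflection r A x =
      simple_reflection r A y \<circ> (word_product r A m \<circ> simple_reflection r A x)"
    by (simp add: word_product_Cons comp_assoc)
  also have "\<dots> = simple_reflection r A y \<circ> (simple_reflection r A x \<circ> word_product r A m)"
    by (subst Cons.IH) (use Cons.prems in simp_all)
  also have "\<dots> = (simple_reflection r A y \<circ> simple_reflection r A x) \<circ> word_product r A m"
    by (simp only: comp_assoc)
  also have "simple_reflection r A y \<circ> simple_reflection r A x =
      simple_reflection r A x \<circ> simple_reflection r A y"
    using Cons.prems[of y] assms(1) by (intro simple_reflections_commute) auto
  finally show ?case by (simp add: word_product_Cons comp_assoc)
qed

text \<open>
  Otherwise the letters between the two occurrences of x commute with x, the two occurrences can be
  brought together, and they cancel: the word was not of minimal length.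
\<close>

lemma reduced_word_separated:
  assumes "cartan_matrix r A" "reduced_word r A u (a @ x # m @ x # b)" "x \<notin> set m"
  shows "\<exists>y\<in>set m. A x y < 0"
proof (rule ccontr)
  assume contra: "\<not> ?thesis"
  have r: "set (a @ x # m @ x # b) \<subseteq> {1..r}" and u: "word_product r A (a @ x # m @ x # b) = u"
    and len: "length (a @ x # m @ x # b) = weyl_length r A u"
    using assms(2) unfolding reduced_word_def by blast+
  have x: "x \<in> {1..r}" using r by auto
  have Axx: "A x x = 2" using assms(1) x by (auto simp: cartan_matrix_def)
  have comm: "y \<in> {1..r} \<and> y \<noteq> x \<and> A x y = 0 \<and> A y x = 0" if y: "y \<in> set m" for y
  proof -
    have yr: "y \<in> {1..r}" "y \<noteq> x" using r y assms(3) by auto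
    then have "A x y \<le> 0" "A x y = 0 \<longleftrightarrow> A y x = 0"
      using assms(1) x unfolding cartan_matrix_def by metis+
    moreover have "\<not> A x y < 0" using contra y by blast
    ultimately show ?thesis using yr by linarith
  qed
  let ?s = "simple_reflection r A x"
  have "u = word_product r A a \<circ> (?s \<circ> (word_product r A m \<circ> ?s) \<circ> word_product r A b)"
    by (simp add: u[symmetric] word_product_append word_product_Cons comp_assoc)
  also have "?s \<circ> (word_product r A m \<circ> ?s) = (?s \<circ> ?s) \<circ> word_product r A m"
    using word_product_commute[OF x comm] by (simp add: comp_assoc)
  also have "\<dots> = word_product r A m"
    using simple_reflection_involution[of x r A, OF x Axx] by simp
  finally have "word_product r A (a @ m @ b) = u"
    by (simp add: word_product_append fun_eq_iff)
  moreover have "set (a @ m @ b) \<subseteq> {1..r}" using r by auto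
  ultimately have "weyl_length r A u \<le> length (a @ m @ b)"
    unfolding weyl_length_def by (intro Least_le) blast
  then show False using len by simp
qed

text \<open>
  The letters of one sign in a shuffle form one of the two reduced words, so an occurrence of
  equal letters in the shuffle is one in that reduced word.
\<close>

lemma double_reduced_word_double_word:
  assumes C: "cartan_matrix r A" and "double_reduced_word r A u v w"
  shows "double_word r A w"
proof -
  obtain wu wv where wu: "reduced_word r A u wu" and wv: "reduced_word r A v wv"
    and w: "w \<in> shuffles (map (\<lambda>i. - int i) wu) (map int wv)"
    using assms(2) unfolding double_reduced_word_def by blast
  have r: "set wu \<subseteq> {1..r}" "set wv \<subseteq> {1..r}"
    using wu wv by (auto simp: reduced_word_def)
  have "filter (\<lambda>c. 0 < c) w \<in> shuffles (filter (\<lambda>c. 0 < c) (map (\<lambda>i. - int i) wu))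
      (filter (\<lambda>c. 0 < c) (map int wv))"
    using w filter_shuffles by blast
  moreover have "filter (\<lambda>c. 0 < c) (map (\<lambda>i. - int i) wu) = []"
    by (auto simp: filter_empty_conv)
  moreover have "filter (\<lambda>c. 0 < c) (map int wv) = map int wv"
    using r(2) by (auto simp: filter_id_conv)
  ultimately have pos: "filter (\<lambda>c. 0 < c) w = map int wv" by simp
  have "filter (\<lambda>c. c < 0) w \<in> shuffles (filter (\<lambda>c. c < 0) (map (\<lambda>i. - int i) wu))
      (filter (\<lambda>c. c < 0) (map int wv))"
    using w filter_shuffles by blast
  moreover have "filter (\<lambda>c. c < 0) (map (\<lambda>i. - int i) wu) = map (\<lambda>i. - int i) wu"
    using r(1) by (auto simp: filter_id_conv)
  moreover have "filter (\<lambda>c. c < 0) (map int wv) = []"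
    by (auto simp: filter_empty_conv)
  ultimately have neg: "filter (\<lambda>c. c < 0) w = map (\<lambda>i. - int i) wu" by simp
  have abs_pos: "map (\<lambda>c. nat \<bar>c\<bar>) (filter (\<lambda>c. 0 < c) w) = wv"
    and abs_neg: "map (\<lambda>c. nat \<bar>c\<bar>) (filter (\<lambda>c. c < 0) w) = wu"
    unfolding pos neg by (simp_all add: comp_def)
  have letters: "c \<noteq> 0 \<and> nat \<bar>c\<bar> \<in> {1..r}" if "c \<in> set w" for c
    using that set_shuffles[OF w] r by auto
  show ?thesis
  proof
    show "c \<noteq> 0 \<and> nat \<bar>c\<bar> \<in> {1..r}" if "c \<in> set w" for c
      using letters[OF that] .
    show "A i j < 0 \<longleftrightarrow> A j i < 0" if "i \<in> {1..r}" "j \<in> {1..r}" "i \<noteq> j" for i j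
    proof -
      have "A i j \<le> 0" "A j i \<le> 0" "A i j = 0 \<longleftrightarrow> A j i = 0"
        using C that unfolding cartan_matrix_def by metis+
      then show ?thesis by linarith
    qed
    show "0 \<le> A i i" if "i \<in> {1..r}" for i
      using C that unfolding cartan_matrix_def by simp
    show "\<exists>d\<in>set m. sgn d = sgn c \<and> A (nat \<bar>c\<bar>) (nat \<bar>d\<bar>) < 0"
      if split: "w = a @ c # m @ c # b" and c: "c \<notin> set m" "- c \<notin> set m" for a c m b
    proof -
      let ?P = "\<lambda>d :: int. sgn d = sgn c"
      let ?f = "\<lambda>xs. map (\<lambda>c. nat \<bar>c\<bar>) (filter ?P xs)"
      have c0: "c \<noteq> 0" using letters[of c] split by simp
      have "\<exists>t. reduced_word r A t (?f w)"
      proof (cases "0 < c")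
        case True
        then have "filter ?P w = filter (\<lambda>d. 0 < d) w" by (intro filter_cong) (auto simp: sgn_if)
        then show ?thesis using abs_pos wv by auto
      next
        case False
        then have "filter ?P w = filter (\<lambda>d. d < 0) w"
          using c0 by (intro filter_cong) (auto simp: sgn_if)
        then show ?thesis using abs_neg wu by auto
      qed
      then obtain t where "reduced_word r A t (?f a @ nat \<bar>c\<bar> # ?f m @ nat \<bar>c\<bar> # ?f b)"
        unfolding split by auto
      moreover have "nat \<bar>c\<bar> \<notin> set (?f m)"
      proof
        assume "nat \<bar>c\<bar> \<in> set (?f m)"
        then obtain d where d: "d \<in> set m" "nat \<bar>c\<bar> = nat \<bar>d\<bar>" by auto
        then have "\<bar>d\<bar> = \<bar>c\<bar>" by simp
        then have "d = c \<or> d = - c" by (simp add: abs_eq_iff)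
        then show False using c d(1) by blast
      qed
      ultimately obtain y where "y \<in> set (?f m)" "A (nat \<bar>c\<bar>) y < 0"
        using reduced_word_separated[OF C] by blast
      then show ?thesis by auto
    qed
  qed
qed

theorem theorem3p1:
  fixes r :: nat
    and A :: "nat \<Rightarrow> nat \<Rightarrow> int"
    and u v :: "(nat \<Rightarrow> int) \<Rightarrow> (nat \<Rightarrow> int)"
    and w :: "int list"
  assumes "cartan_matrix r A"
    and "u \<in> weyl_group r A" and "v \<in> weyl_group r A"
    and "double_reduced_word r A u v w"
  shows "dimer_quiver (bfz_quiver r A w) {1..r} (dynkin_edges r A)
           (bfz_frozen r w) (bfz_strand w) (bfz_height r w) (bfz_curve r w)"
  by (rule double_word.bfz_dimer_quiver)
    (rule double_reduced_word_double_word[OF assms(1,4)])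

end
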